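(* Let $G=(V,E)$ be a connected, transitive and locally finite graph, and let ${\rm IC}_G$ be its isoperimetric constant. Let $\delta_{\rm max}\in\mathbb{N}$ satisfy the sparsity condition $$\delta_{\rm max}<\tfrac12\,{\rm IC}_G .$$ Then there is $\beta_0$ such that for every inverse temperature $\beta>\beta_0$ and every $\omega\in\Omega_{\rm GS}(\delta_{\rm max})$, the Gibbs measure $\mu^{\omega}$ of the Ising model on $G$ at inverse temperature $\beta$, obtained as the weak limit of the finite-volume measures $\mu^\omega_\Lambda$ as $\Lambda\uparrow V$ (boundary condition $\omega$), is well-defined and is an extremal element of $\mathcal G_\beta$.
   Context: Spin space $\Omega=\{-1,+1\}^V$. For a finite subgraph $H\subset G$, $|H|$ denotes its number of vertices and $\partial H=\{(v,w)\in E: v\in V(H),\,w\notin V(H)\}$ is its set of emanating edges. The isoperimetric constant is ${\rm IC}_G=\inf\{|\partial H|/|H| : H \text{ a finite non-empty subgraph of } G\}$. For finite $\Lambda\subset V$, $\sigma\in\{-1,+1\}^\Lambda$ and boundary condition $\omega\in\Omega$, the Ising Hamiltonian is $H_\Lambda(\sigma\mid\omega)=\sum_{v\sim w,\ v,w\in\Lambda}\mathbf 1_{\sigma_v\neq\sigma_w}+\sum_{v\sim u,\ v\in\Lambda,\ u\notin\Lambda}\mathbf 1_{\sigma_v\neq\omega_u}$, and $\mu^\omega_\Lambda$ is the probability measure on $\{-1,+1\}^\Lambda$ proportional to $\exp(-\beta H_\Lambda(\sigma\mid\omega))$ (equivalently, to $\exp(\beta(\sum_{\{i,j\}\in E,\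 i,j\in\Lambda}\sigma_i\sigma_j+\sum_{i\in\Lambda,j\notin\Lambda,\,i\sim j}\sigma_i\omega_j))$). $\mathcal G_\beta$ is the set of probability measures $\mu$ on $\Omega$ satisfying the DLR equations $\mu=\int \mu^\omega_\Lambda\,d\mu(\omega)$ for every finite $\Lambda\subset V$; it is a simplex and its extremal elements are those that cannot be written as nontrivial convex combinations. $\Omega_{\rm GS}(\delta_{\rm max})$ is the set of $\omega\in\Omega$ such that every vertex $i\in V$ has at most $\delta_{\rm max}$ incident edges $\{i,j\}$ with $\omega_i\neq\omega_j$ (frustrated edges). *)

theory Defs
  imports "HOL-Probability.Probability"
begin

(* Graph G = (V,E): vertex set V = UNIV :: 'v set, adjacency relation adj (symmetric, irreflexive).
   Spins: a spin configuration is  'v \<Rightarrow> bool , True = +1, False = -1. *)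

definition simple_graph :: "('v \<Rightarrow> 'v \<Rightarrow> bool) \<Rightarrow> bool" where
  "simple_graph adj \<longleftrightarrow> (\<forall>v w. adj v w \<longleftrightarrow> adj w v) \<and> (\<forall>v. \<not> adj v v)"

definition locally_finite :: "('v \<Rightarrow> 'v \<Rightarrow> bool) \<Rightarrow> bool" where
  "locally_finite adj \<longleftrightarrow> (\<forall>v. finite {w. adj v w})"

definition connected_graph :: "('v \<Rightarrow> 'v \<Rightarrow> bool) \<Rightarrow> bool" where
  "connected_graph adj \<longleftrightarrow> (\<forall>v w. (v, w) \<in> {(a, b). adj a b}\<^sup>*)"

definition graph_automorphism :: "('v \<Rightarrow> 'v \<Rightarrow> bool) \<Rightarrow> ('v \<Rightarrow> 'v) \<Rightarrow> bool" where
  "graph_automorphism adj \<phi> \<longleftrightarrow> bij \<phi> \<and> (\<forall>a b. adj a b \<longleftrightarrow> adj (\<phi> a) (\<phi> b))"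

definition vertex_transitive :: "('v \<Rightarrow> 'v \<Rightarrow> bool) \<Rightarrow> bool" where
  "vertex_transitive adj \<longleftrightarrow> (\<forall>v w. \<exists>\<phi>. graph_automorphism adj \<phi> \<and> \<phi> v = w)"

(* emanating edges of a finite subgraph with vertex set S *)
definition edge_boundary :: "('v \<Rightarrow> 'v \<Rightarrow> bool) \<Rightarrow> 'v set \<Rightarrow> ('v \<times> 'v) set" where
  "edge_boundary adj S = {(v, w). adj v w \<and> v \<in> S \<and> w \<notin> S}"

definition isoperimetric_constant :: "('v \<Rightarrow> 'v \<Rightarrow> bool) \<Rightarrow> real" where
  "isoperimetric_constant adj =
     Inf {real (card (edge_boundary adj S)) / real (card S) | S. finite S \<and> S \<noteq> {}}"

(* ground states with at most dmax frustrated edges at every vertex *)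
definition Omega_GS :: "('v \<Rightarrow> 'v \<Rightarrow> bool) \<Rightarrow> nat \<Rightarrow> ('v \<Rightarrow> bool) set" where
  "Omega_GS adj dmax = {\<omega>. \<forall>i. card {j. adj i j \<and> \<omega> i \<noteq> \<omega> j} \<le> dmax}"

(* spin space with the product sigma-algebra *)
definition spin_space :: "('v \<Rightarrow> bool) measure" where
  "spin_space = PiM UNIV (\<lambda>_. count_space UNIV)"

(* Hamiltonian H_\<Lambda>(\<sigma>|\<omega>); only the values of \<sigma> on \<Lambda> matter *)
definition hamiltonian :: "('v \<Rightarrow> 'v \<Rightarrow> bool) \<Rightarrow> 'v set \<Rightarrow> ('v \<Rightarrow> bool) \<Rightarrow> ('v \<Rightarrow> bool) \<Rightarrow> nat" where
  "hamiltonian adj \<Lambda> \<sigma> \<omega> =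
     card {{v, w} | v w. adj v w \<and> v \<in> \<Lambda> \<and> w \<in> \<Lambda> \<and> \<sigma> v \<noteq> \<sigma> w}
   + card {(v, u). adj v u \<and> v \<in> \<Lambda> \<and> u \<notin> \<Lambda> \<and> \<sigma> v \<noteq> \<omega> u}"

(* configurations equal to \<omega> outside \<Lambda> (identified with {-1,+1}^\<Lambda>) *)
definition local_configs :: "'v set \<Rightarrow> ('v \<Rightarrow> bool) \<Rightarrow> ('v \<Rightarrow> bool) set" where
  "local_configs \<Lambda> \<omega> = {\<eta>. \<forall>x. x \<notin> \<Lambda> \<longrightarrow> \<eta> x = \<omega> x}"

definition gibbs_weight :: "real \<Rightarrow> ('v \<Rightarrow> 'v \<Rightarrow> bool) \<Rightarrow> 'v set \<Rightarrow> ('v \<Rightarrow> bool) \<Rightarrow> ('v \<Rightarrow> bool) \<Rightarrow> real" where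
  "gibbs_weight \<beta> adj \<Lambda> \<omega> \<eta> =
     (if \<eta> \<in> local_configs \<Lambda> \<omega> then exp (- \<beta> * real (hamiltonian adj \<Lambda> \<eta> \<omega>)) else 0)"

definition partition_function :: "real \<Rightarrow> ('v \<Rightarrow> 'v \<Rightarrow> bool) \<Rightarrow> 'v set \<Rightarrow> ('v \<Rightarrow> bool) \<Rightarrow> real" where
  "partition_function \<beta> adj \<Lambda> \<omega> = (\<Sum>\<eta>\<in>local_configs \<Lambda> \<omega>. gibbs_weight \<beta> adj \<Lambda> \<omega> \<eta>)"

(* finite-volume Gibbs measure \<mu>^\<omega>_\<Lambda>, as a probability measure on the whole spin space
   (spins outside \<Lambda> frozen to \<omega>) *)
definition finite_gibbs :: "real \<Rightarrow> ('v \<Rightarrow> 'v \<Rightarrow> bool) \<Rightarrow> 'v set \<Rightarrow> ('v \<Rightarrow> bool) \<Rightarrow> ('v \<Rightarrow> bool) measure" where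
  "finite_gibbs \<beta> adj \<Lambda> \<omega> =
     distr (density (count_space UNIV)
              (\<lambda>\<eta>. ennreal (gibbs_weight \<beta> adj \<Lambda> \<omega> \<eta> / partition_function \<beta> adj \<Lambda> \<omega>)))
           spin_space (\<lambda>\<eta>. \<eta>)"

(* DLR Gibbs measures G_\<beta> *)
definition gibbs_measures :: "real \<Rightarrow> ('v \<Rightarrow> 'v \<Rightarrow> bool) \<Rightarrow> ('v \<Rightarrow> bool) measure set" where
  "gibbs_measures \<beta> adj =
     {\<mu>. prob_space \<mu> \<and> sets \<mu> = sets spin_space \<and>
          (\<forall>\<Lambda>. finite \<Lambda> \<longrightarrow> (\<forall>A \<in> sets spin_space.
              emeasure \<mu> A = (\<integral>\<^sup>+ \<omega>. emeasure (finite_gibbs \<beta> adj \<Lambda> \<omega>) A \<partial>\<mu>)))}"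

(* extremal element: not a nontrivial convex combination of two elements of G_\<beta> *)
definition extremal_gibbs :: "real \<Rightarrow> ('v \<Rightarrow> 'v \<Rightarrow> bool) \<Rightarrow> ('v \<Rightarrow> bool) measure \<Rightarrow> bool" where
  "extremal_gibbs \<beta> adj \<mu> \<longleftrightarrow> \<mu> \<in> gibbs_measures \<beta> adj \<and>
     (\<forall>\<mu>1 \<in> gibbs_measures \<beta> adj. \<forall>\<mu>2 \<in> gibbs_measures \<beta> adj. \<forall>t::real.
        0 < t \<and> t < 1 \<and>
        (\<forall>A \<in> sets spin_space. measure \<mu> A = t * measure \<mu>1 A + (1 - t) * measure \<mu>2 A)
        \<longrightarrow> \<mu>1 = \<mu>2)"

(* product topology of discrete topologies on {-1,+1}^V *)
definition spin_topology :: "('v \<Rightarrow> bool) topology" where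
  "spin_topology = product_topology (\<lambda>_. discrete_topology UNIV) UNIV"

(* weak convergence of \<mu>^\<omega>_\<Lambda> to \<mu> as \<Lambda> \<up> V (net of finite subsets of V) *)
definition weak_limit_gibbs :: "real \<Rightarrow> ('v \<Rightarrow> 'v \<Rightarrow> bool) \<Rightarrow> ('v \<Rightarrow> bool) \<Rightarrow> ('v \<Rightarrow> bool) measure \<Rightarrow> bool" where
  "weak_limit_gibbs \<beta> adj \<omega> \<mu> \<longleftrightarrow> prob_space \<mu> \<and> sets \<mu> = sets spin_space \<and>
     (\<forall>f. continuous_map spin_topology euclideanreal f \<longrightarrow>
        ((\<lambda>\<Lambda>. integral\<^sup>L (finite_gibbs \<beta> adj \<Lambda> \<omega>) f) \<longlongrightarrow> integral\<^sup>L \<mu> f)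
          (finite_subsets_at_top UNIV))"

end

theory Submission
  imports Defs
begin

text \<open>
  Take two independent configurations, each from a finite-volume or an infinite-volume Gibbs measure,
  and call a vertex disagreeing if at least one of them differs from \<open>\<omega>\<close> there. On the clusters of
  disagreeing vertices that meet a finite set \<open>B\<close>, both configurations see the boundary condition
  \<open>\<omega>\<close>; if these clusters are finite, exchanging the two configurations on them preserves the joint
  law. Hence the laws on \<open>B\<close> differ by at most the probability that \<open>B\<close> meets a large cluster.

  Flipping a set \<open>F\<close> of disagreeing spins of one configuration back to \<open>\<omega>\<close> gains at least
  \<open>|\<partial>F| - 2 \<delta>\<^sub>m\<^sub>a\<^sub>x |F| \<ge> (IC - 2 \<delta>\<^sub>m\<^sub>a\<^sub>x) |F|\<close> in energy, so by a Peierls sum over connected sets large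
  clusters are exponentially unlikely at low temperature. This makes the finite-volume marginals a
  Cauchy net. If the limit is \<open>\<mu> = t \<mu>\<^sub>1 + (1 - t) \<mu>\<^sub>2\<close>, then \<open>\<mu>\<^sub>1 \<le> \<mu> / t\<close>, so clusters for the pair
  \<open>(\<mu>\<^sub>1, \<mu>)\<close> are still finite almost surely and \<open>\<mu>\<^sub>1 = \<mu>\<close>.
\<close>

section \<open>Connected finite vertex sets\<close>

text \<open>The obstacle is that a flip estimate prices only finite clusters, whose surroundings are
  pinned to \<omega>; a general Gibbs measure may charge infinite clusters. The estimate is
  therefore proved in finite volume, where spins outside are frozen, with a bound independent of the
  volume. To survive the limit, "large cluster" is expressed as a connected set of exactly
  \<open>n\<close> vertices rooted in \<open>B\<close>, an event that sees finitely many spins.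
  Finite-volume measures, infinite-volume measures and candidate limits are all treated as families
  of cylinder probabilities \<open>p J \<xi>\<close>, so that every argument about pairs is a finite
  sum over a window \<open>J\<close>. The Peierls ratio
  \<open>4 * deg ^ 2 * exp (- \<beta> * c)\<close> with c = IC - 2 \<open>dmax\<close> collects
  three factors per cluster vertex: at most 4 ways to say which copy deviates there,
  \<open>deg ^ 2\<close> for the shape of the cluster, and the energy cost. Asking for a ratio at
  most 1/2 makes the geometric tail at most twice its first term.\<close>

locale bounded_degree_graph =
  fixes adj :: "'v \<Rightarrow> 'v \<Rightarrow> bool" and deg :: nat
  assumes adj_sym: "adj v w \<Longrightarrow> adj w v"
    and finite_neighbours: "finite {w. adj v w}"
    and card_neighbours: "card {w. adj v w} \<le> deg"
    and deg_pos: "1 \<le> deg"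
begin

text \<open>Finite connected sets with a marked root. Growth by one vertex at a time replaces paths
  inside the set and gives the induction used for tours, truncation and unions.\<close>

inductive animal :: "'v \<Rightarrow> 'v set \<Rightarrow> bool" for v where
  root: "animal v {v}"
| grow: "animal v C \<Longrightarrow> w \<in> C \<Longrightarrow> adj w u \<Longrightarrow> u \<notin> C \<Longrightarrow> animal v (insert u C)"

lemma animal_finite: "animal v C \<Longrightarrow> finite C"
  by (induction rule: animal.induct) auto

lemma animal_root_mem: "animal v C \<Longrightarrow> v \<in> C"
  by (induction rule: animal.induct) auto

text \<open>The growth of \<open>B\<close> is replayed on top of \<open>A\<close>: the common root
  starts it, and vertices already present are skipped.\<close>

lemma animal_Un:
  assumes "animal v B" "animal v A"
  shows "animal v (A \<union> B)"
  using assms(1)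
proof (induction rule: animal.induct)
  case root
  then show ?case using assms(2) animal_root_mem by (metis Un_insert_right insert_absorb sup_bot_right)
next
  case (grow C w u)
  show ?case
  proof (cases "u \<in> A \<union> C")
    case True
    then show ?thesis using grow by (simp add: insert_absorb)
  next
    case False
    then show ?thesis using animal.grow[OF grow.IH _ grow.hyps(3)] grow.hyps(2) by simp
  qed
qed

text \<open>Each growth step adds exactly one vertex, so the growth passes through every
  intermediate cardinality.\<close>

lemma animal_truncate:
  assumes "animal v C" "1 \<le> n" "n \<le> card C"
  shows "\<exists>C'\<subseteq>C. animal v C' \<and> card C' = n"
  using assms
proof (induction rule: animal.induct)
  case root
  then show ?case using animal.root[of v] by (intro exI[of _ "{v}"]) auto
next
  case (grow C w u)
  show ?case
  proof (cases "n \<le> card C")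
    case True
    then show ?thesis using grow by blast
  next
    case False
    then have "card (insert u C) = n"
      using grow animal_finite by auto
    then show ?thesis using animal.grow grow.hyps by blast
  qed
qed

lemma successively_detour:
  "successively adj (xs @ w # ys) \<Longrightarrow> adj w u \<Longrightarrow> successively adj (xs @ w # u # w # ys)"
  using adj_sym by (auto simp: successively_append_iff)

text \<open>A depth-first tour of a spanning tree: each new vertex is spliced in as a detour.\<close>

lemma animal_walk:
  assumes "animal v C"
  shows "\<exists>xs. length xs + 1 = 2 * card C \<and> set xs = C \<and> hd xs = v \<and> successively adj xs"
  using assms
proof (induction rule: animal.induct)
  case root
  show ?case by (rule exI[of _ "[v]"]) auto
next
  case (grow C w u)
  then obtain xs where xs: "length xs + 1 = 2 * card C" "set xs = C" "hd xs = v" "successively adj xs"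
    by blast
  then obtain ys zs where yz: "xs = ys @ w # zs"
    using grow.hyps(2) by (metis in_set_conv_decomp)
  let ?xs = "ys @ w # u # w # zs"
  have "successively adj ?xs" using xs yz grow.hyps successively_detour by blast
  moreover have "hd ?xs = v" using xs yz by (cases ys) auto
  moreover have "set ?xs = insert u C" using xs yz by auto
  moreover have "length ?xs + 1 = 2 * card (insert u C)"
    using xs yz grow.hyps animal_finite by auto
  ultimately show ?case by blast
qed

text \<open>Beyond the fixed start, each of the \<open>m\<close> steps has at most
  \<open>deg\<close> choices; the induction removes the first vertex and takes the union over its
  neighbours.\<close>

lemma walks_bound:
  "finite {xs. length xs = Suc m \<and> hd xs = v \<and> successively adj xs} \<and>
   card {xs. length xs = Suc m \<and> hd xs = v \<and> successively adj xs} \<le> deg ^ m"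
proof (induction m arbitrary: v)
  case 0
  have "{xs. length xs = Suc 0 \<and> hd xs = v \<and> successively adj xs} = {[v]}"
    by (auto simp: length_Suc_conv)
  then show ?case by simp
next
  case (Suc m)
  let ?W = "\<lambda>v m. {xs. length xs = Suc m \<and> hd xs = v \<and> successively adj xs}"
  let ?U = "\<Union>w\<in>{w. adj v w}. ?W w m"
  have sub: "?W v (Suc m) \<subseteq> (#) v ` ?U"
  proof
    fix xs assume xs: "xs \<in> ?W v (Suc m)"
    then obtain x y ys where "xs = x # y # ys" by (auto simp: length_Suc_conv)
    then show "xs \<in> (#) v ` ?U" using xs by auto
  qed
  have fin: "finite ?U" using Suc finite_neighbours by blast
  have "card ?U \<le> (\<Sum>w\<in>{w. adj v w}. card (?W w m))"
    by (rule card_UN_le[OF finite_neighbours])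
  also have "\<dots> \<le> (\<Sum>w\<in>{w. adj v w}. deg ^ m)"
    using Suc by (intro sum_mono) blast
  also have "\<dots> \<le> deg ^ Suc m" using card_neighbours by simp
  finally have "card ((#) v ` ?U) \<le> deg ^ Suc m"
    using card_image_le[OF fin, of "(#) v"] by linarith
  then show ?case
    using sub fin card_mono[OF _ sub] by (meson finite_imageI finite_subset order_trans)
qed

text \<open>An animal is the vertex set of one of its tours, so there are no more animals than
  tours. For m = k + 1 a tour has 2k steps; the exponent is relaxed to 2m, which needs
  \<open>deg_pos\<close>, to obtain a formula that fits the geometric series.\<close>

lemma animals_bound:
  "finite {C. animal v C \<and> card C = m} \<and> card {C. animal v C \<and> card C = m} \<le> deg ^ (2 * m)"
proof (cases m)
  case 0
  then have "{C. animal v C \<and> card C = m} = {}"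
    using animal_finite animal_root_mem by fastforce
  then show ?thesis by (metis card.empty finite.emptyI le0)
next
  case (Suc k)
  let ?W = "{xs. length xs = Suc (2 * k) \<and> hd xs = v \<and> successively adj xs}"
  have sub: "{C. animal v C \<and> card C = m} \<subseteq> set ` ?W"
  proof
    fix C assume "C \<in> {C. animal v C \<and> card C = m}"
    then obtain xs where "length xs + 1 = 2 * m" "set xs = C" "hd xs = v" "successively adj xs"
      using animal_walk by blast
    then show "C \<in> set ` ?W" using Suc by auto
  qed
  have fin: "finite ?W" and "card ?W \<le> deg ^ (2 * k)"
    using walks_bound by blast+
  then have "card (set ` ?W) \<le> deg ^ (2 * k)"
    using card_image_le le_trans by blast
  also have "\<dots> \<le> deg ^ (2 * m)"
    using Suc deg_pos by (intro power_increasing) auto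
  finally show ?thesis
    using sub fin card_mono[OF _ sub] by (meson finite_imageI finite_subset order_trans)
qed

section \<open>Clusters, their neighbourhoods and the local percolation event\<close>

definition cluster :: "'v set \<Rightarrow> 'v \<Rightarrow> 'v set" where
  "cluster D v = \<Union>{C. animal v C \<and> C \<subseteq> D}"

lemma cluster_subset: "cluster D v \<subseteq> D"
  by (auto simp: cluster_def)

lemma cluster_mem: "v \<in> D \<Longrightarrow> v \<in> cluster D v"
  using animal.root[of v] by (auto simp: cluster_def intro!: exI[of _ "{v}"])

text \<open>Maximality of the cluster: a neighbour in \<open>D\<close> can be grown onto any animal
  inside \<open>D\<close>. Consequently the outer boundary of a cluster misses
  \<open>D\<close>.\<close>

lemma cluster_closed:
  assumes "w \<in> cluster D v" "adj w u" "u \<in> D"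
  shows "u \<in> cluster D v"
proof -
  obtain C where C: "animal v C" "C \<subseteq> D" "w \<in> C"
    using assms(1) by (auto simp: cluster_def)
  then have "animal v (insert u C)"
    using animal.grow[OF C(1,3) assms(2)] by (cases "u \<in> C") (auto simp: insert_absorb)
  then show ?thesis using C assms(3) by (auto simp: cluster_def)
qed

text \<open>A finite \<open>D\<close> contains only finitely many animals, and animals with the same
  root are closed under union.\<close>

lemma cluster_animal:
  assumes "finite D" "v \<in> D"
  shows "animal v (cluster D v)"
proof -
  let ?S = "{C. animal v C \<and> C \<subseteq> D}"
  have fin: "finite ?S" using assms(1) by (auto intro: finite_subset[of _ "Pow D"])
  have ne: "?S \<noteq> {}" using animal.root[of v] assms(2) by (auto intro!: exI[of _ "{v}"])
  have "finite T \<Longrightarrow> T \<noteq> {} \<Longrightarrow> T \<subseteq> ?S \<Longrightarrow> animal v (\<Union>T)" for T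
    by (induction T rule: finite_ne_induct) (auto intro: animal_Un)
  then show ?thesis unfolding cluster_def using fin ne by blast
qed

definition nbhd :: "'v set \<Rightarrow> 'v set" where
  "nbhd K = K \<union> {w. \<exists>v\<in>K. adj v w}"

lemma subset_nbhd: "K \<subseteq> nbhd K"
  by (auto simp: nbhd_def)

lemma nbhd_mono: "K \<subseteq> L \<Longrightarrow> nbhd K \<subseteq> nbhd L"
  by (auto simp: nbhd_def)

lemma finite_nbhd: "finite K \<Longrightarrow> finite (nbhd K)"
proof -
  assume "finite K"
  moreover have "{w. \<exists>v\<in>K. adj v w} = (\<Union>v\<in>K. {w. adj v w})" by auto
  ultimately show ?thesis using finite_neighbours by (simp add: nbhd_def)
qed

text \<open>For n >= 1, \<open>animal_truncate\<close> makes exact size equivalent to size at least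
  \<open>n\<close>. The exact form makes the event depend on \<open>D\<close> only inside the finite
  set \<open>reach n B\<close>.\<close>

definition percolates :: "nat \<Rightarrow> 'v set \<Rightarrow> 'v set \<Rightarrow> bool" where
  "percolates n B D \<longleftrightarrow> (\<exists>v\<in>B. \<exists>C\<subseteq>D. animal v C \<and> card C = n)"

definition reach :: "nat \<Rightarrow> 'v set \<Rightarrow> 'v set" where
  "reach n B = \<Union>{C. \<exists>v\<in>B. animal v C \<and> card C \<le> n}"

lemma finite_reach:
  assumes "finite B"
  shows "finite (reach n B)"
proof -
  have "{C. \<exists>v\<in>B. animal v C \<and> card C \<le> n} = (\<Union>v\<in>B. \<Union>m\<in>{..n}. {C. animal v C \<and> card C = m})"
    by auto
  then have "finite {C. \<exists>v\<in>B. animal v C \<and> card C \<le> n}"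
    using assms animals_bound by simp
  then show ?thesis unfolding reach_def using animal_finite by blast
qed

lemma animal_subset_reach: "v \<in> B \<Longrightarrow> animal v C \<Longrightarrow> card C \<le> n \<Longrightarrow> C \<subseteq> reach n B"
  by (auto simp: reach_def)

lemma percolates_cong:
  assumes "D \<inter> reach n B = D' \<inter> reach n B"
  shows "percolates n B D = percolates n B D'"
proof -
  have "C \<subseteq> D \<longleftrightarrow> C \<subseteq> D'" if "v \<in> B" "animal v C" "card C = n" for v C
    using assms animal_subset_reach[OF that(1,2), of n] that(3) by blast
  then show ?thesis unfolding percolates_def by blast
qed

text \<open>A cluster with more than \<open>n\<close> vertices would contain an animal with the same
  root and exactly \<open>n\<close> of them.\<close>

lemma cluster_subset_reach:
  assumes "finite D" "v \<in> B" "1 \<le> n" "\<not> percolates n B D"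
  shows "cluster D v \<subseteq> reach n B"
proof (cases "v \<in> D")
  case True
  note an = cluster_animal[OF assms(1) True]
  have "card (cluster D v) \<le> n"
  proof (rule ccontr)
    assume "\<not> ?thesis"
    then obtain C' where "C' \<subseteq> cluster D v" "animal v C'" "card C' = n"
      using animal_truncate[OF an assms(3)] by auto
    then show False using assms(2,4) cluster_subset[of D v] unfolding percolates_def by blast
  qed
  then show ?thesis using animal_subset_reach[OF assms(2) an] by blast
next
  case False
  then have "{C. animal v C \<and> C \<subseteq> D} = {}" using animal_root_mem by blast
  then show ?thesis unfolding cluster_def by (metis Union_empty empty_subsetI)
qed

end

section \<open>Families of finite-dimensional marginals\<close>

definition cyl :: "'v set \<Rightarrow> ('v \<Rightarrow> bool) \<Rightarrow> ('v \<Rightarrow> bool) set" where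
  "cyl J \<xi> = {\<eta>. \<forall>x\<in>J. \<eta> x = \<xi> x}"

definition graft :: "'v set \<Rightarrow> ('v \<Rightarrow> bool) \<Rightarrow> ('v \<Rightarrow> bool) \<Rightarrow> 'v \<Rightarrow> bool" where
  "graft J \<eta> \<xi> = (\<lambda>x. if x \<in> J then \<eta> x else \<xi> x)"

lemma graft_apply: "graft J \<eta> \<xi> x = (if x \<in> J then \<eta> x else \<xi> x)"
  by (simp add: graft_def)

lemma local_configs_iff: "\<eta> \<in> local_configs J \<omega> \<longleftrightarrow> (\<forall>x. x \<notin> J \<longrightarrow> \<eta> x = \<omega> x)"
  by (simp add: local_configs_def)

lemma graft_in_local_configs: "graft J \<eta> \<omega> \<in> local_configs J \<omega>"
  by (simp add: local_configs_iff graft_apply)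

lemma finite_local_configs:
  assumes "finite J"
  shows "finite (local_configs J \<omega>)"
proof -
  have "local_configs J \<omega> \<subseteq> (\<lambda>F. graft J (\<lambda>x. x \<in> F) \<omega>) ` Pow J"
  proof
    fix \<eta> assume "\<eta> \<in> local_configs J \<omega>"
    then have "\<eta> = graft J (\<lambda>x. x \<in> {x \<in> J. \<eta> x}) \<omega>"
      by (auto simp: local_configs_iff graft_apply fun_eq_iff)
    then show "\<eta> \<in> (\<lambda>F. graft J (\<lambda>x. x \<in> F) \<omega>) ` Pow J" by blast
  qed
  then show ?thesis using assms finite_subset by blast
qed

text \<open>\<open>p J \<xi>\<close> stands for the probability of the cylinder of \<xi> over
  \<open>J\<close>. Configurations are total functions, hence the clause that values off
  \<open>J\<close> are ignored; the last clause sums out the spins of \<open>K\<close>. No measure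
  is required, so limits of marginals qualify before a measure has been built.\<close>

definition consistent :: "('v set \<Rightarrow> ('v \<Rightarrow> bool) \<Rightarrow> real) \<Rightarrow> bool" where
  "consistent p \<longleftrightarrow> (\<forall>J \<xi>. 0 \<le> p J \<xi>) \<and> (\<forall>\<xi>. p {} \<xi> = 1) \<and>
     (\<forall>J \<xi> \<xi>'. (\<forall>x\<in>J. \<xi> x = \<xi>' x) \<longrightarrow> p J \<xi> = p J \<xi>') \<and>
     (\<forall>J K \<xi>. finite J \<longrightarrow> K \<subseteq> J \<longrightarrow> p (J - K) \<xi> = (\<Sum>\<zeta>\<in>local_configs K \<xi>. p J \<zeta>))"

lemma consistentD:
  assumes "consistent p"
  shows consistent_nonneg: "0 \<le> p J \<xi>"
    and consistent_empty: "p {} \<xi> = 1"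
    and consistent_cong: "(\<And>x. x \<in> J \<Longrightarrow> \<xi> x = \<xi>' x) \<Longrightarrow> p J \<xi> = p J \<xi>'"
    and consistent_sum: "finite J \<Longrightarrow> K \<subseteq> J \<Longrightarrow> p (J - K) \<xi> = (\<Sum>\<zeta>\<in>local_configs K \<xi>. p J \<zeta>)"
proof -
  note * = assms[unfolded consistent_def]
  show "0 \<le> p J \<xi>" "p {} \<xi> = 1" using * by simp_all
  show "p J \<xi> = p J \<xi>'" if "\<And>x. x \<in> J \<Longrightarrow> \<xi> x = \<xi>' x"
    using *[THEN conjunct2, THEN conjunct2, THEN conjunct1] that by metis
  show "p (J - K) \<xi> = (\<Sum>\<zeta>\<in>local_configs K \<xi>. p J \<zeta>)" if "finite J" "K \<subseteq> J"
    using *[THEN conjunct2, THEN conjunct2, THEN conjunct2] that by metis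
qed

text \<open>The expectation of a function of the spins in \<open>J\<close> may be computed in any
  larger window. The configurations over \<open>J'\<close> are grouped by their restriction to
  \<open>J\<close>, which \<open>graft\<close> turns back into a configuration equal to \<omega> off
  \<open>J\<close>.\<close>

lemma consistent_transfer:
  fixes h :: "('v \<Rightarrow> bool) \<Rightarrow> real"
  assumes p: "consistent p" and J: "finite J'" "J \<subseteq> J'"
  shows "(\<Sum>\<xi>\<in>local_configs J \<omega>. p J \<xi> * h \<xi>) =
         (\<Sum>\<zeta>\<in>local_configs J' \<omega>. p J' \<zeta> * h (graft J \<zeta> \<omega>))"
proof -
  have J_eq: "J' - (J' - J) = J" using J by blast
  have "(\<Sum>\<xi>\<in>local_configs J \<omega>. p J \<xi> * h \<xi>) =
        (\<Sum>\<xi>\<in>local_configs J \<omega>. \<Sum>\<zeta>\<in>local_configs (J' - J) \<xi>. p J' \<zeta> * h \<xi>)"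
    using consistent_sum[OF p J(1), of "J' - J"] by (simp add: J_eq sum_distrib_right)
  also have "\<dots> = (\<Sum>(\<xi>, \<zeta>)\<in>(SIGMA \<xi>:local_configs J \<omega>. local_configs (J' - J) \<xi>). p J' \<zeta> * h \<xi>)"
    using J by (intro sum.Sigma) (auto intro: finite_local_configs finite_subset)
  also have "\<dots> = (\<Sum>\<zeta>\<in>local_configs J' \<omega>. p J' \<zeta> * h (graft J \<zeta> \<omega>))"
  proof (rule sum.reindex_bij_witness[of _ "\<lambda>\<zeta>. (graft J \<zeta> \<omega>, \<zeta>)" snd])
    have *: "graft J \<zeta> \<omega> = \<xi>"
      if "\<xi> \<in> local_configs J \<omega>" "\<zeta> \<in> local_configs (J' - J) \<xi>" for \<xi> \<zeta>
      using that by (auto simp: local_configs_iff graft_apply fun_eq_iff)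
    fix a assume "a \<in> (SIGMA \<xi>:local_configs J \<omega>. local_configs (J' - J) \<xi>)"
    then show "(graft J (snd a) \<omega>, snd a) = a" "snd a \<in> local_configs J' \<omega>"
      "p J' (snd a) * h (graft J (snd a) \<omega>) = (case a of (\<xi>, \<zeta>) \<Rightarrow> p J' \<zeta> * h \<xi>)"
      using J(2) by (auto simp: * ) (auto simp: local_configs_iff)
  qed (use J in \<open>auto simp: local_configs_iff graft_apply\<close>)
  finally show ?thesis .
qed

text \<open>After transfer to the window \<open>J\<close>, a single configuration of
  \<open>local_configs J \<omega>\<close> lies in the cylinder, namely
  \<open>graft J \<rho> \<omega>\<close>.\<close>

lemma consistent_marginal:
  assumes p: "consistent p" and J: "finite J'" "J \<subseteq> J'"
  shows "(\<Sum>\<zeta>\<in>local_configs J' \<omega>. p J' \<zeta> * of_bool (\<zeta> \<in> cyl J \<rho>)) = p J \<rho>"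
proof -
  have "graft J \<zeta> \<omega> \<in> cyl J \<rho> \<longleftrightarrow> \<zeta> \<in> cyl J \<rho>" for \<zeta>
    by (auto simp: cyl_def graft_apply)
  then have "(\<Sum>\<zeta>\<in>local_configs J' \<omega>. p J' \<zeta> * of_bool (\<zeta> \<in> cyl J \<rho>)) =
      (\<Sum>\<xi>\<in>local_configs J \<omega>. p J \<xi> * of_bool (\<xi> \<in> cyl J \<rho>))"
    by (simp only: consistent_transfer[OF p J, where \<omega>=\<omega>])
  also have "\<dots> = (\<Sum>\<xi>\<in>local_configs J \<omega>. p J \<xi> * of_bool (\<xi> = graft J \<rho> \<omega>))"
  proof (rule sum.cong[OF refl])
    fix \<xi> assume "\<xi> \<in> local_configs J \<omega>"
    then have "\<xi> \<in> cyl J \<rho> \<longleftrightarrow> \<xi> = graft J \<rho> \<omega>"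
      by (auto simp: local_configs_iff cyl_def graft_apply fun_eq_iff)
    then show "p J \<xi> * of_bool (\<xi> \<in> cyl J \<rho>) = p J \<xi> * of_bool (\<xi> = graft J \<rho> \<omega>)" by simp
  qed
  also have "\<dots> = p J (graft J \<rho> \<omega>)"
    using finite_local_configs[of J \<omega>] J graft_in_local_configs[of J \<rho> \<omega>]
    by (subst sum.remove[of _ "graft J \<rho> \<omega>"]) (auto simp: finite_subset intro!: sum.neutral)
  also have "\<dots> = p J \<rho>"
    by (rule consistent_cong[OF p]) (simp add: graft_apply)
  finally show ?thesis .
qed

lemma consistent_sum_1:
  assumes "consistent p" "finite J"
  shows "(\<Sum>\<zeta>\<in>local_configs J \<omega>. p J \<zeta>) = 1"
  using consistent_sum[OF assms, of J \<omega>] consistent_empty[OF assms(1)] by simp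

lemma consistent_le_1:
  assumes "consistent p" "finite J"
  shows "p J \<xi> \<le> 1"
proof -
  have "p J \<xi> \<le> (\<Sum>\<zeta>\<in>local_configs J \<xi>. p J \<zeta>)"
    using assms by (intro member_le_sum) (auto simp: finite_local_configs local_configs_iff consistent_nonneg)
  then show ?thesis using consistent_sum_1[OF assms] by simp
qed

section \<open>Swapping two copies on the disagreement clusters\<close>

definition flip :: "('v \<Rightarrow> bool) \<Rightarrow> 'v set \<Rightarrow> 'v \<Rightarrow> bool" where
  "flip \<omega> F = (\<lambda>x. if x \<in> F then \<not> \<omega> x else \<omega> x)"

text \<open>The copies are compared with \<omega>, not with each other: around a cluster each copy
  separately shows \<omega>, as the Peierls estimate requires.\<close>

definition disagreement :: "('v \<Rightarrow> bool) \<Rightarrow> ('v \<Rightarrow> bool) \<Rightarrow> ('v \<Rightarrow> bool) \<Rightarrow> 'v set" where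
  "disagreement \<omega> \<xi> \<xi>' = {x. \<xi> x \<noteq> \<omega> x \<or> \<xi>' x \<noteq> \<omega> x}"

lemma sum_UN_le:
  fixes f :: "'a \<Rightarrow> real"
  assumes "finite I" "\<And>i. i \<in> I \<Longrightarrow> finite (A i)" "\<And>x. 0 \<le> f x"
  shows "sum f (\<Union>i\<in>I. A i) \<le> (\<Sum>i\<in>I. sum f (A i))"
  using assms(1,2)
proof (induction I rule: finite_induct)
  case (insert i I)
  have "sum f (A i \<union> (\<Union>i\<in>I. A i)) + sum f (A i \<inter> (\<Union>i\<in>I. A i)) = sum f (A i) + sum f (\<Union>i\<in>I. A i)"
    using insert by (intro sum.union_inter) auto
  moreover have "0 \<le> sum f (A i \<inter> (\<Union>i\<in>I. A i))" using assms(3) by (simp add: sum_nonneg)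
  ultimately show ?case using insert by simp
qed simp

lemma sum_power_tail_le:
  fixes r :: real
  assumes "0 \<le> r" "r \<le> 1 / 2"
  shows "(\<Sum>m=n..<n + k. r ^ m) \<le> 2 * r ^ n"
proof -
  \<comment> \<open>The added remainder is what makes the induction close: the next term plus its
    own remainder costs at most the old remainder, as 2r <= 1.\<close>
  have "(\<Sum>m=n..<n + k. r ^ m) + 2 * r ^ (n + k) \<le> 2 * r ^ n"
  proof (induction k)
    case (Suc k)
    have "(2 * r) * r ^ (n + k) \<le> 1 * r ^ (n + k)"
      using assms by (intro mult_right_mono) auto
    then show ?case using Suc by simp
  qed simp
  then show ?thesis using zero_le_power[OF assms(1), of "n + k"] by linarith
qed

context bounded_degree_graph
begin

text \<open>The configuration serves as its own boundary condition, so one total function carries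
  both arguments of the Hamiltonian.\<close>

abbreviation energy :: "'v set \<Rightarrow> ('v \<Rightarrow> bool) \<Rightarrow> nat" where
  "energy K \<xi> \<equiv> hamiltonian adj K \<xi> \<xi>"

lemma hamiltonian_cong:
  assumes "\<And>x. x \<in> K \<Longrightarrow> \<xi> x = \<xi>' x" "\<And>x. x \<in> nbhd K \<Longrightarrow> x \<notin> K \<Longrightarrow> \<omega> x = \<omega>' x"
  shows "hamiltonian adj K \<xi> \<omega> = hamiltonian adj K \<xi>' \<omega>'"
proof -
  have "{{v, w} | v w. adj v w \<and> v \<in> K \<and> w \<in> K \<and> \<xi> v \<noteq> \<xi> w} =
        {{v, w} | v w. adj v w \<and> v \<in> K \<and> w \<in> K \<and> \<xi>' v \<noteq> \<xi>' w}"
    using assms(1) by (metis (no_types, opaque_lifting))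
  moreover have "{(v, u). adj v u \<and> v \<in> K \<and> u \<notin> K \<and> \<xi> v \<noteq> \<omega> u} =
        {(v, u). adj v u \<and> v \<in> K \<and> u \<notin> K \<and> \<xi>' v \<noteq> \<omega>' u}"
    using assms by (auto simp: nbhd_def)
  ultimately show ?thesis by (simp add: hamiltonian_def)
qed

text \<open>The DLR equation in the volume \<open>K\<close>, stated without the partition function.\<close>

definition balanced :: "real \<Rightarrow> ('v set \<Rightarrow> ('v \<Rightarrow> bool) \<Rightarrow> real) \<Rightarrow> 'v set \<Rightarrow> bool" where
  "balanced \<beta> p K \<longleftrightarrow> (\<forall>J \<xi> \<xi>'. finite J \<longrightarrow> nbhd K \<subseteq> J \<longrightarrow> (\<forall>x. x \<notin> K \<longrightarrow> \<xi> x = \<xi>' x) \<longrightarrow>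
     p J \<xi> * exp (- \<beta> * real (energy K \<xi>')) = p J \<xi>' * exp (- \<beta> * real (energy K \<xi>)))"

text \<open>The probability of \<open>percolates\<close> for two independent copies with laws
  \<open>p\<close> and \<open>q\<close>, seen through the window \<open>J\<close>. It is meaningful
  once \<open>reach n B\<close> lies in \<open>J\<close>; the window then no longer matters.\<close>

definition percolation_prob ::
    "('v \<Rightarrow> bool) \<Rightarrow> ('v set \<Rightarrow> ('v \<Rightarrow> bool) \<Rightarrow> real) \<Rightarrow> ('v set \<Rightarrow> ('v \<Rightarrow> bool) \<Rightarrow> real) \<Rightarrow>
     'v set \<Rightarrow> nat \<Rightarrow> 'v set \<Rightarrow> real" where
  "percolation_prob \<omega> p q J n B =
     (\<Sum>\<xi>\<in>local_configs J \<omega>. \<Sum>\<xi>'\<in>local_configs J \<omega>.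
        p J \<xi> * q J \<xi>' * of_bool (percolates n B (disagreement \<omega> \<xi> \<xi>')))"

text \<open>Since the copies coincide around \<open>K\<close>, each inherits the energy of the other
  after the exchange. The two Boltzmann ratios are reciprocal and cancel in the product.\<close>

lemma balanced_swap:
  assumes bp: "balanced \<beta> p K" and bq: "balanced \<beta> q K"
    and J: "finite J" "nbhd K \<subseteq> J"
    and out: "\<And>x. x \<in> nbhd K \<Longrightarrow> x \<notin> K \<Longrightarrow> \<xi> x = \<xi>' x"
  shows "p J (graft K \<xi>' \<xi>) * q J (graft K \<xi> \<xi>') = p J \<xi> * q J \<xi>'"
proof -
  let ?w = "\<lambda>\<xi>. exp (- \<beta> * real (energy K \<xi>))"
  have e: "energy K (graft K \<xi>' \<xi>) = energy K \<xi>'" "energy K (graft K \<xi> \<xi>') = energy K \<xi>"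
    by (intro hamiltonian_cong; use out in \<open>auto simp: graft_apply\<close>)+
  have "p J \<xi> * ?w \<xi>' = p J (graft K \<xi>' \<xi>) * ?w \<xi>"
    using bp J unfolding balanced_def e(1)[symmetric] by (auto simp: graft_apply)
  moreover have "q J \<xi>' * ?w \<xi> = q J (graft K \<xi> \<xi>') * ?w \<xi>'"
    using bq J unfolding balanced_def e(2)[symmetric] by (auto simp: graft_apply)
  ultimately have "(p J \<xi> * ?w \<xi>') * (q J \<xi>' * ?w \<xi>) =
      (p J (graft K \<xi>' \<xi>) * ?w \<xi>) * (q J (graft K \<xi> \<xi>') * ?w \<xi>')"
    by presburger
  then show ?thesis by simp
qed

text \<open>The swap \<open>T\<close> is an involution on non-percolating pairs that keeps the
  weight \<open>f\<close> and reverses the sign of the observable \<open>g\<close>. These pairs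
  contribute zero in total, and on the others |g| is at most 1.\<close>

lemma marginal_diff_le:
  assumes p: "consistent p" and q: "consistent q"
    and J: "finite J" "B \<subseteq> J" "nbhd (reach n B) \<subseteq> J" and n: "1 \<le> n"
    and bal: "\<And>K. K \<subseteq> reach n B \<Longrightarrow> balanced \<beta> p K \<and> balanced \<beta> q K"
  shows "\<bar>p B \<rho> - q B \<rho>\<bar> \<le> percolation_prob \<omega> p q J n B"
proof -
  let ?\<Omega> = "local_configs J \<omega>"
  let ?bad = "\<lambda>z. percolates n B (disagreement \<omega> (fst z) (snd z))"
  define f where "f z = p J (fst z) * q J (snd z)" for z
  define g :: "('v \<Rightarrow> bool) \<times> ('v \<Rightarrow> bool) \<Rightarrow> real" where
    "g z = of_bool (fst z \<in> cyl B \<rho>) - of_bool (snd z \<in> cyl B \<rho>)" for z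
  have fin: "finite ?\<Omega>" using J by (simp add: finite_local_configs)
  have f0: "0 \<le> f z" for z by (simp add: f_def consistent_nonneg[OF p] consistent_nonneg[OF q])
  \<comment> \<open>Each marginal is multiplied by the total mass 1 of the other copy, to write the
    difference as a sum over pairs.\<close>
  have "p B \<rho> - q B \<rho> =
      (\<Sum>\<xi>\<in>?\<Omega>. p J \<xi> * of_bool (\<xi> \<in> cyl B \<rho>)) * (\<Sum>\<xi>'\<in>?\<Omega>. q J \<xi>') -
      (\<Sum>\<xi>\<in>?\<Omega>. p J \<xi>) * (\<Sum>\<xi>'\<in>?\<Omega>. q J \<xi>' * of_bool (\<xi>' \<in> cyl B \<rho>))"
    by (simp only: consistent_marginal[OF p J(1,2)] consistent_marginal[OF q J(1,2)]
        consistent_sum_1[OF p J(1)] consistent_sum_1[OF q J(1)] mult_1 mult_1_right)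
  also have "\<dots> = (\<Sum>\<xi>\<in>?\<Omega>. \<Sum>\<xi>'\<in>?\<Omega>. f (\<xi>, \<xi>') * g (\<xi>, \<xi>'))"
    by (simp only: sum_product sum_subtractf[symmetric])
       (auto intro!: sum.cong simp: f_def g_def algebra_simps)
  also have "\<dots> = (\<Sum>z\<in>?\<Omega> \<times> ?\<Omega>. f z * g z)"
    by (simp add: sum.cartesian_product)
  also have "\<dots> = (\<Sum>z\<in>{z \<in> ?\<Omega> \<times> ?\<Omega>. \<not> ?bad z}. f z * g z) + (\<Sum>z\<in>{z \<in> ?\<Omega> \<times> ?\<Omega>. ?bad z}. f z * g z)"
    using fin by (subst sum.union_disjoint[symmetric]) (auto intro!: sum.cong)
  also have "(\<Sum>z\<in>{z \<in> ?\<Omega> \<times> ?\<Omega>. \<not> ?bad z}. f z * g z) = 0"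
  proof -
    let ?S = "{z \<in> ?\<Omega> \<times> ?\<Omega>. \<not> ?bad z}"
    define K where "K z = (\<Union>v\<in>B. cluster (disagreement \<omega> (fst z) (snd z)) v)" for z
    define T where "T z = (graft (K z) (snd z) (fst z), graft (K z) (fst z) (snd z))" for z
    \<comment> \<open>Disagreement is symmetric in the two copies at each vertex, so the swap does
      not move the set on which it acts; this makes it an involution.\<close>
    have dis: "disagreement \<omega> (fst (T z)) (snd (T z)) = disagreement \<omega> (fst z) (snd z)" for z
      by (auto simp: T_def disagreement_def graft_apply)
    then have KT: "K (T z) = K z" for z by (simp add: K_def)
    have TT: "T (T z) = z" for z
      unfolding T_def[of "T z"] KT by (auto simp: T_def graft_apply fun_eq_iff prod_eq_iff)
    have TS: "T z \<in> ?S" if "z \<in> ?S" for z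
      using that dis[of z] by (auto simp: T_def local_configs_iff graft_apply)
    have eqs: "f (T z) = f z \<and> g (T z) = - g z" if z: "z \<in> ?S" for z
    proof -
      let ?D = "disagreement \<omega> (fst z) (snd z)"
      have "?D \<subseteq> J" using z by (auto simp: disagreement_def local_configs_iff)
      then have finD: "finite ?D" using J finite_subset by blast
      have KR: "K z \<subseteq> reach n B"
        using cluster_subset_reach[OF finD _ n] z unfolding K_def by blast
      have out: "fst z x = \<omega> x \<and> snd z x = \<omega> x" if "x \<in> nbhd (K z)" "x \<notin> K z" for x
        using that cluster_closed unfolding K_def nbhd_def disagreement_def by blast
      \<comment> \<open>Vertices of \<open>B\<close> left unswapped carry \<omega> in both copies,
        so on all of \<open>B\<close> the effect of \<open>T\<close> is a full exchange.\<close>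
      have outB: "fst z x = \<omega> x \<and> snd z x = \<omega> x" if "x \<in> B" "x \<notin> K z" for x
      proof -
        have "x \<notin> ?D" using that cluster_mem[of x ?D] unfolding K_def by blast
        then show ?thesis by (simp add: disagreement_def)
      qed
      have "nbhd (K z) \<subseteq> J" using nbhd_mono[OF KR] J by blast
      then have "f (T z) = f z"
        unfolding f_def T_def fst_conv snd_conv
        by (intro balanced_swap[where \<beta>=\<beta>]) (use bal[OF KR] J out in auto)
      moreover have "fst (T z) x = snd z x \<and> snd (T z) x = fst z x" if "x \<in> B" for x
        using outB[OF that] by (auto simp: T_def graft_apply)
      then have "g (T z) = - g z" by (simp add: g_def cyl_def)
      ultimately show ?thesis by blast
    qed
    have "(\<Sum>z\<in>?S. f z * g z) = (\<Sum>z\<in>?S. - (f z * g z))"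
      by (rule sum.reindex_bij_witness[of _ T T]) (use TT TS eqs in auto)
    then show ?thesis by (simp add: sum_negf)
  qed
  finally have "\<bar>p B \<rho> - q B \<rho>\<bar> = \<bar>\<Sum>z\<in>{z \<in> ?\<Omega> \<times> ?\<Omega>. ?bad z}. f z * g z\<bar>" by simp
  also have "\<dots> \<le> (\<Sum>z\<in>{z \<in> ?\<Omega> \<times> ?\<Omega>. ?bad z}. \<bar>f z * g z\<bar>)" by (rule sum_abs)
  also have "\<dots> \<le> (\<Sum>z\<in>{z \<in> ?\<Omega> \<times> ?\<Omega>. ?bad z}. f z * of_bool (?bad z))"
    by (intro sum_mono) (auto simp: g_def abs_mult f0)
  also have "\<dots> = (\<Sum>z\<in>?\<Omega> \<times> ?\<Omega>. f z * of_bool (?bad z))"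
    using fin by (intro sum.mono_neutral_left) auto
  also have "\<dots> = percolation_prob \<omega> p q J n B"
    by (simp add: percolation_prob_def sum.cartesian_product f_def split_def)
  finally show ?thesis .
qed

section \<open>Peierls estimate\<close>

text \<open>Flipping \<open>F\<close> leaves edges inside \<open>F\<close> unchanged and exchanges
  frustrated (\<open>?X\<close>) with satisfied (\<open>?Y\<close>) boundary edges. The cost is |Y|
  - |X| = |boundary| - 2|X|, and |X| is at most \<open>dmax\<close> per vertex of
  \<open>F\<close>.\<close>

lemma energy_flip_ge:
  assumes \<omega>: "\<omega> \<in> Omega_GS adj dmax" and F: "finite F"
    and iso: "\<kappa> * real (card F) \<le> real (card (edge_boundary adj F))"
  shows "real (energy F \<omega>) + (\<kappa> - 2 * real dmax) * real (card F) \<le> real (energy F (flip \<omega> F))"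
proof -
  let ?I = "\<lambda>\<xi>. {{v, w} | v w. adj v w \<and> v \<in> F \<and> w \<in> F \<and> \<xi> v \<noteq> \<xi> w}"
  let ?X = "{(v, u). adj v u \<and> v \<in> F \<and> u \<notin> F \<and> \<omega> v \<noteq> \<omega> u}"
  let ?Y = "{(v, u). adj v u \<and> v \<in> F \<and> u \<notin> F \<and> \<omega> v = \<omega> u}"
  have I: "?I (flip \<omega> F) = ?I \<omega>"
    by (rule Collect_cong) (auto simp: flip_def)
  have Y: "{(v, u). adj v u \<and> v \<in> F \<and> u \<notin> F \<and> flip \<omega> F v \<noteq> flip \<omega> F u} = ?Y"
    by (auto simp: flip_def)
  have b: "edge_boundary adj F = ?X \<union> ?Y" by (auto simp: edge_boundary_def)
  have "edge_boundary adj F \<subseteq> nbhd F \<times> nbhd F" by (auto simp: edge_boundary_def nbhd_def)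
  then have "finite (edge_boundary adj F)" using F finite_nbhd finite_subset by blast
  then have fin: "finite ?X" "finite ?Y" using b by auto
  have "card (?X \<union> ?Y) = card ?X + card ?Y"
    using fin by (intro card_Un_disjoint) auto
  then have sum: "card (edge_boundary adj F) = card ?X + card ?Y" by (simp only: b)
  have "?X \<subseteq> (SIGMA v:F. {j. adj v j \<and> \<omega> v \<noteq> \<omega> j})" by auto
  moreover have finS: "finite {j. adj v j \<and> \<omega> v \<noteq> \<omega> j}" for v
    using finite_neighbours[of v] by (rule rev_finite_subset) auto
  ultimately have "card ?X \<le> card (SIGMA v:F. {j. adj v j \<and> \<omega> v \<noteq> \<omega> j})"
    using F by (intro card_mono) auto
  also have "\<dots> = (\<Sum>v\<in>F. card {j. adj v j \<and> \<omega> v \<noteq> \<omega> j})"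
    using F finS by (intro card_SigmaI) auto
  also have "\<dots> \<le> (\<Sum>v\<in>F. dmax)"
    using \<omega> by (intro sum_mono) (auto simp: Omega_GS_def)
  finally have "card ?X \<le> card F * dmax" by simp
  then have "real (card ?X) \<le> real (card F) * real dmax"
    unfolding of_nat_mult[symmetric] of_nat_le_iff .
  then show ?thesis
    using iso sum unfolding hamiltonian_def I Y by (simp add: algebra_simps)
qed

text \<open>\<open>a\<close> is the price per flipped vertex. The condition on the window forces the
  outer boundary of \<open>F\<close> to be observed in the state \<omega>, so that \<open>F\<close>
  is an isolated excitation.\<close>

definition suppressed :: "('v \<Rightarrow> bool) \<Rightarrow> real \<Rightarrow> ('v set \<Rightarrow> ('v \<Rightarrow> bool) \<Rightarrow> real) \<Rightarrow> bool" where
  "suppressed \<omega> a p \<longleftrightarrow> (\<forall>J F. finite J \<longrightarrow> nbhd F \<subseteq> J \<longrightarrow> p J (flip \<omega> F) \<le> a ^ card F)"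

definition frozen_outside :: "('v \<Rightarrow> bool) \<Rightarrow> 'v set \<Rightarrow> ('v set \<Rightarrow> ('v \<Rightarrow> bool) \<Rightarrow> real) \<Rightarrow> bool" where
  "frozen_outside \<omega> \<Lambda> p \<longleftrightarrow> (\<forall>J \<xi> x. finite J \<longrightarrow> x \<in> J \<longrightarrow> x \<notin> \<Lambda> \<longrightarrow> \<xi> x \<noteq> \<omega> x \<longrightarrow> p J \<xi> = 0)"

text \<open>Balance in the volume \<open>F\<close> compares \<open>flip \<omega> F\<close> with
  \<omega> itself: the ratio is the exponential of the energy cost, and \<open>p J \<omega>\<close>
  is at most 1. If \<open>F\<close> leaves \<Lambda>, freezing gives probability zero.\<close>

lemma suppressed_of_balanced:
  assumes p: "consistent p" and \<omega>: "\<omega> \<in> Omega_GS adj dmax" and "0 \<le> \<beta>"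
    and bal: "\<And>K. K \<subseteq> \<Lambda> \<Longrightarrow> balanced \<beta> p K" and fr: "frozen_outside \<omega> \<Lambda> p"
    and iso: "\<And>F. finite F \<Longrightarrow> \<kappa> * real (card F) \<le> real (card (edge_boundary adj F))"
  shows "suppressed \<omega> (exp (- \<beta> * (\<kappa> - 2 * real dmax))) p"
  unfolding suppressed_def
proof (intro allI impI)
  fix J F assume J: "finite J" "nbhd F \<subseteq> J"
  have F: "F \<subseteq> J" using J subset_nbhd by blast
  then have finF: "finite F" using J finite_subset by blast
  let ?c = "\<kappa> - 2 * real dmax"
  show "p J (flip \<omega> F) \<le> exp (- \<beta> * ?c) ^ card F"
  proof (cases "F \<subseteq> \<Lambda>")
    case False
    then obtain x where "x \<in> F" "x \<notin> \<Lambda>" by blast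
    then have "x \<in> J" "flip \<omega> F x \<noteq> \<omega> x" using F by (auto simp: flip_def)
    then have "p J (flip \<omega> F) = 0"
      using fr[unfolded frozen_outside_def, rule_format, OF J(1) _ \<open>x \<notin> \<Lambda>\<close>] by blast
    then show ?thesis by simp
  next
    case True
    have "p J (flip \<omega> F) * exp (- \<beta> * real (energy F \<omega>)) = p J \<omega> * exp (- \<beta> * real (energy F (flip \<omega> F)))"
      by (rule bal[OF True, unfolded balanced_def, rule_format, OF J]) (simp add: flip_def)
    then have "p J (flip \<omega> F) = p J \<omega> * exp (- \<beta> * (real (energy F (flip \<omega> F)) - real (energy F \<omega>)))"
      by (simp add: right_diff_distrib exp_diff exp_minus field_simps)
    also have "\<dots> \<le> 1 * exp (- \<beta> * (?c * real (card F)))"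
    proof (intro mult_mono)
      have "\<beta> * (?c * real (card F)) \<le> \<beta> * (real (energy F (flip \<omega> F)) - real (energy F \<omega>))"
        using energy_flip_ge[OF \<omega> finF iso[OF finF]] \<open>0 \<le> \<beta>\<close> by (intro mult_left_mono) auto
      then show "exp (- \<beta> * (real (energy F (flip \<omega> F)) - real (energy F \<omega>))) \<le> exp (- \<beta> * (?c * real (card F)))"
        by simp
    qed (use consistent_le_1[OF p J(1)] in auto)
    also have "\<dots> = exp (- \<beta> * ?c) ^ card F"
      by (simp add: exp_of_nat_mult[symmetric] algebra_simps)
    finally show ?thesis .
  qed
qed

text \<open>By \<open>percolates_cong\<close> the event is unchanged when both copies are reset to
  \<omega> off \<open>J\<close>; \<open>consistent_transfer\<close> is then applied to one copy
  after the other.\<close>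

lemma percolation_prob_enlarge:
  assumes p: "consistent p" and q: "consistent q"
    and J: "finite J'" "J \<subseteq> J'" "reach n B \<subseteq> J"
  shows "percolation_prob \<omega> p q J n B = percolation_prob \<omega> p q J' n B"
proof -
  let ?b = "\<lambda>\<xi> \<xi>'. of_bool (percolates n B (disagreement \<omega> \<xi> \<xi>')) :: real"
  have b: "?b (graft J \<xi> \<omega>) (graft J \<xi>' \<omega>) = ?b \<xi> \<xi>'" for \<xi> \<xi>'
    by (rule arg_cong[where f=of_bool], rule percolates_cong)
       (use J(3) in \<open>auto simp: disagreement_def graft_apply\<close>)
  have "percolation_prob \<omega> p q J n B =
      (\<Sum>\<xi>\<in>local_configs J \<omega>. p J \<xi> * (\<Sum>\<xi>'\<in>local_configs J \<omega>. q J \<xi>' * ?b \<xi> \<xi>'))"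
    by (simp add: percolation_prob_def sum_distrib_left mult.assoc)
  also have "\<dots> = (\<Sum>\<xi>\<in>local_configs J \<omega>. p J \<xi> *
      (\<Sum>\<xi>'\<in>local_configs J' \<omega>. q J' \<xi>' * ?b \<xi> (graft J \<xi>' \<omega>)))"
    by (subst consistent_transfer[OF q J(1,2)]) simp
  also have "\<dots> = (\<Sum>\<xi>\<in>local_configs J' \<omega>. p J' \<xi> *
      (\<Sum>\<xi>'\<in>local_configs J' \<omega>. q J' \<xi>' * ?b (graft J \<xi> \<omega>) (graft J \<xi>' \<omega>)))"
    by (rule consistent_transfer[OF p J(1,2)])
  also have "\<dots> = percolation_prob \<omega> p q J' n B"
    by (simp add: percolation_prob_def sum_distrib_left mult.assoc b)
  finally show ?thesis .
qed

text \<open>The Peierls sum. Freezing outside the finite \<Lambda> makes each cluster finite; it is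
  summed over together with the sets \<open>F\<close> and \<open>G\<close> where the first and
  second copy deviate. The final bound does not contain \<Lambda>.\<close>

lemma percolation_prob_le:
  assumes p: "consistent p" and q: "consistent q"
    and sp: "suppressed \<omega> a p" and sq: "suppressed \<omega> a q"
    and \<Lambda>: "finite \<Lambda>" and fp: "frozen_outside \<omega> \<Lambda> p" and fq: "frozen_outside \<omega> \<Lambda> q"
    and J: "finite J" "reach n B \<subseteq> J" and B: "finite B"
    and a: "0 \<le> a" "a \<le> 1" and r: "4 * real deg ^ 2 * a \<le> 1 / 2"
  shows "percolation_prob \<omega> p q J n B \<le> 2 * real (card B) * (4 * real deg ^ 2 * a) ^ n"
proof -
  \<comment> \<open>The window must show every possible cluster together with its outer
    boundary.\<close>
  define J' where "J' = J \<union> nbhd \<Lambda>"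
  have J': "finite J'" "J \<subseteq> J'" "nbhd \<Lambda> \<subseteq> J'" using J \<Lambda> finite_nbhd by (auto simp: J'_def)
  let ?\<Omega> = "local_configs J' \<omega>"
  let ?r = "4 * real deg ^ 2 * a"
  define \<C> where "\<C> = {C. C \<subseteq> \<Lambda> \<and> n \<le> card C \<and> (\<exists>v\<in>B. animal v C)}"
  define \<T> where "\<T> = (SIGMA C:\<C>. {(F, G). F \<subseteq> C \<and> G \<subseteq> C \<and> F \<union> G = C})"
  define t where "t C F G \<xi> \<xi>' = (p J' \<xi> * of_bool (\<xi> \<in> cyl (nbhd C) (flip \<omega> F))) *
      (q J' \<xi>' * of_bool (\<xi>' \<in> cyl (nbhd C) (flip \<omega> G)))" for C F G \<xi> \<xi>'
  have fin\<Omega>: "finite ?\<Omega>" using J' by (simp add: finite_local_configs)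
  have fin\<C>: "finite \<C>" using \<Lambda> by (auto simp: \<C>_def intro: finite_subset[of _ "Pow \<Lambda>"])
  have finC: "finite C" if "C \<in> \<C>" for C using that \<Lambda> by (auto simp: \<C>_def intro: finite_subset)
  have pairs: "{(F, G). F \<subseteq> C \<and> G \<subseteq> C \<and> F \<union> G = C} \<subseteq> Pow C \<times> Pow C" for C :: "'v set" by auto
  have fin\<T>: "finite \<T>" unfolding \<T>_def
    using fin\<C> finC pairs by (meson finite_Pow_iff finite_SigmaI finite_subset)
  have t0: "0 \<le> t C F G \<xi> \<xi>'" for C F G \<xi> \<xi>'
    by (simp add: t_def consistent_nonneg[OF p] consistent_nonneg[OF q])
  have point: "p J' \<xi> * q J' \<xi>' * of_bool (percolates n B (disagreement \<omega> \<xi> \<xi>')) \<le>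
      (\<Sum>(C, F, G)\<in>\<T>. t C F G \<xi> \<xi>')" if \<xi>: "\<xi> \<in> ?\<Omega>" "\<xi>' \<in> ?\<Omega>" for \<xi> \<xi>'
  proof (cases "p J' \<xi> * q J' \<xi>' = 0 \<or> \<not> percolates n B (disagreement \<omega> \<xi> \<xi>')")
    case True
    moreover have "0 \<le> (\<Sum>(C, F, G)\<in>\<T>. t C F G \<xi> \<xi>')" using t0 by (auto intro!: sum_nonneg)
    ultimately show ?thesis by auto
  next
    case False
    let ?D = "disagreement \<omega> \<xi> \<xi>'"
    have D\<Lambda>: "?D \<subseteq> \<Lambda>"
    proof
      fix x assume x: "x \<in> ?D"
      then have "x \<in> J'" using \<xi> by (auto simp: disagreement_def local_configs_iff)
      then show "x \<in> \<Lambda>" using x False fp fq J' unfolding frozen_outside_def disagreement_def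
        by (metis (mono_tags, lifting) mem_Collect_eq mult_eq_0_iff)
    qed
    then have finD: "finite ?D" using \<Lambda> finite_subset by blast
    obtain v C' where v: "v \<in> B" "C' \<subseteq> ?D" "animal v C'" "card C' = n"
      using False by (auto simp: percolates_def)
    \<comment> \<open>The animal \<open>C'\<close> of size \<open>n\<close> may have deviating
      neighbours; only the complete cluster is surrounded by \<omega>, so the sum runs over all
      sizes from \<open>n\<close> on.\<close>
    define C where "C = cluster ?D v"
    have an: "animal v C" unfolding C_def
      using v animal_root_mem finD by (intro cluster_animal) auto
    have "C' \<subseteq> C" using v by (auto simp: C_def cluster_def)
    then have "n \<le> card C" using v(4) card_mono[OF animal_finite[OF an]] by blast
    moreover have CD: "C \<subseteq> ?D" by (simp add: C_def cluster_subset)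
    ultimately have C: "C \<in> \<C>" using D\<Lambda> an v by (auto simp: \<C>_def)
    define F where "F = {x \<in> C. \<xi> x \<noteq> \<omega> x}"
    define G where "G = {x \<in> C. \<xi>' x \<noteq> \<omega> x}"
    have "F \<union> G = C" using CD by (auto simp: F_def G_def disagreement_def)
    then have T: "(C, F, G) \<in> \<T>" using C by (auto simp: \<T>_def)
    have out: "x \<notin> ?D" if "x \<in> nbhd C" "x \<notin> C" for x
      using that cluster_closed unfolding C_def nbhd_def by blast
    have "\<xi> \<in> cyl (nbhd C) (flip \<omega> F)" "\<xi>' \<in> cyl (nbhd C) (flip \<omega> G)"
      using out by (auto simp: cyl_def flip_def F_def G_def disagreement_def)
    then have "p J' \<xi> * q J' \<xi>' * of_bool (percolates n B ?D) = t C F G \<xi> \<xi>'"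
      using False by (simp add: t_def)
    also have "\<dots> = (\<lambda>(C, F, G). t C F G \<xi> \<xi>') (C, F, G)" by simp
    also have "\<dots> \<le> (\<Sum>(C, F, G)\<in>\<T>. t C F G \<xi> \<xi>')"
      using T t0 fin\<T> by (intro member_le_sum) auto
    finally show ?thesis .
  qed
  have "percolation_prob \<omega> p q J n B = percolation_prob \<omega> p q J' n B"
    by (rule percolation_prob_enlarge[OF p q J'(1,2) J(2)])
  also have "\<dots> \<le> (\<Sum>\<xi>\<in>?\<Omega>. \<Sum>\<xi>'\<in>?\<Omega>. \<Sum>(C, F, G)\<in>\<T>. t C F G \<xi> \<xi>')"
    unfolding percolation_prob_def by (intro sum_mono point)
  also have "\<dots> = (\<Sum>(C, F, G)\<in>\<T>. \<Sum>\<xi>\<in>?\<Omega>. \<Sum>\<xi>'\<in>?\<Omega>. t C F G \<xi> \<xi>')"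
    unfolding split_def by (subst sum.swap[of _ ?\<Omega> \<T>])+ (rule refl)
  also have "\<dots> \<le> (\<Sum>(C, F, G)\<in>\<T>. a ^ card C)"
  proof (intro sum_mono, clarify)
    fix C F G assume T: "(C, F, G) \<in> \<T>"
    then have C\<C>: "C \<in> \<C>" and FG: "F \<subseteq> C" "G \<subseteq> C" "F \<union> G = C" by (auto simp: \<T>_def)
    have C: "finite C" "C \<subseteq> \<Lambda>" using finC[OF C\<C>] C\<C> by (simp_all add: \<C>_def)
    have nb: "nbhd C \<subseteq> J'" using nbhd_mono[OF C(2)] J' by blast
    \<comment> \<open>Independence of the copies: the double sum factorises into two cylinder
      probabilities.\<close>
    have "(\<Sum>\<xi>\<in>?\<Omega>. \<Sum>\<xi>'\<in>?\<Omega>. t C F G \<xi> \<xi>') = p (nbhd C) (flip \<omega> F) * q (nbhd C) (flip \<omega> G)"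
      unfolding t_def sum_product[symmetric]
      by (simp only: consistent_marginal[OF p J'(1) nb] consistent_marginal[OF q J'(1) nb])
    also have "\<dots> \<le> a ^ card F * a ^ card G"
      using a sp[unfolded suppressed_def, rule_format, OF finite_nbhd[OF C(1)] nbhd_mono[OF FG(1)]]
        sq[unfolded suppressed_def, rule_format, OF finite_nbhd[OF C(1)] nbhd_mono[OF FG(2)]]
      by (intro mult_mono) (auto simp: consistent_nonneg[OF q])
    \<comment> \<open>\<open>F\<close> and \<open>G\<close> cover \<open>C\<close>, so |F| + |G| >=
      |C|, and a <= 1.\<close>
    also have "\<dots> \<le> a ^ card C"
      unfolding power_add[symmetric] using a FG card_Un_le[of F G] by (intro power_decreasing) auto
    finally show "(\<Sum>\<xi>\<in>?\<Omega>. \<Sum>\<xi>'\<in>?\<Omega>. t C F G \<xi> \<xi>') \<le> a ^ card C" .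
  qed
  also have "\<dots> = (\<Sum>C\<in>\<C>. \<Sum>z\<in>{(F, G). F \<subseteq> C \<and> G \<subseteq> C \<and> F \<union> G = C}. a ^ card C)"
    unfolding \<T>_def split_def using fin\<C> finC pairs
    by (subst sum.Sigma) (auto simp: split_def intro: finite_subset[OF pairs[unfolded split_def]])
  also have "\<dots> \<le> (\<Sum>C\<in>\<C>. (4 * a) ^ card C)"
  proof (rule sum_mono)
    fix C assume "C \<in> \<C>"
    then have C: "finite C" by (rule finC)
    \<comment> \<open>The exact number is 3 to the power |C|; dropping the covering condition costs
      only a worse constant.\<close>
    have "card {(F, G). F \<subseteq> C \<and> G \<subseteq> C \<and> F \<union> G = C} \<le> card (Pow C \<times> Pow C)"
      using C pairs by (intro card_mono) auto
    also have "\<dots> = 4 ^ card C"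
      using C by (simp add: card_cartesian_product card_Pow power_mult_distrib[symmetric])
    finally have "real (card {(F, G). F \<subseteq> C \<and> G \<subseteq> C \<and> F \<union> G = C}) \<le> real (4 ^ card C)"
      unfolding of_nat_le_iff .
    then show "(\<Sum>z\<in>{(F, G). F \<subseteq> C \<and> G \<subseteq> C \<and> F \<union> G = C}. a ^ card C) \<le> (4 * a) ^ card C"
      using a by (simp add: power_mult_distrib mult_right_mono)
  qed
  \<comment> \<open>Clusters lie in \<Lambda>, so their sizes stay below the upper limit. The cutoff
    keeps the sum finite and disappears in the geometric tail bound.\<close>
  also have "\<dots> \<le> (\<Sum>(v, m)\<in>B \<times> {n..<n + Suc (card \<Lambda>)}. \<Sum>C\<in>{C. animal v C \<and> card C = m}. (4 * a) ^ card C)"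
  proof -
    let ?I = "B \<times> {n..<n + Suc (card \<Lambda>)}"
    have "\<C> \<subseteq> (\<Union>(v, m)\<in>?I. {C. animal v C \<and> card C = m})"
    proof
      fix C assume "C \<in> \<C>"
      then obtain v where "v \<in> B" "animal v C" "n \<le> card C" "C \<subseteq> \<Lambda>" by (auto simp: \<C>_def)
      moreover have "card C \<le> card \<Lambda>" using \<open>C \<subseteq> \<Lambda>\<close> \<Lambda> card_mono by blast
      ultimately show "C \<in> (\<Union>(v, m)\<in>?I. {C. animal v C \<and> card C = m})"
        by (auto intro!: bexI[of _ v] bexI[of _ "card C"])
    qed
    then have "(\<Sum>C\<in>\<C>. (4 * a) ^ card C) \<le> (\<Sum>C\<in>(\<Union>(v, m)\<in>?I. {C. animal v C \<and> card C = m}). (4 * a) ^ card C)"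
      using a B animals_bound by (intro sum_mono2) (auto simp: split_def)
    also have "\<dots> \<le> (\<Sum>i\<in>?I. \<Sum>C\<in>(\<lambda>(v, m). {C. animal v C \<and> card C = m}) i. (4 * a) ^ card C)"
      using a B animals_bound by (intro sum_UN_le) (auto simp: split_def)
    finally show ?thesis by (simp add: split_def)
  qed
  also have "\<dots> \<le> (\<Sum>(v, m)\<in>B \<times> {n..<n + Suc (card \<Lambda>)}. ?r ^ m)"
  proof (intro sum_mono, clarify)
    fix v m
    have "(\<Sum>C\<in>{C. animal v C \<and> card C = m}. (4 * a) ^ card C) =
        real (card {C. animal v C \<and> card C = m}) * (4 * a) ^ m"
      by simp
    also have "\<dots> \<le> real (deg ^ (2 * m)) * (4 * a) ^ m"
      using a animals_bound by (intro mult_right_mono) (auto simp: of_nat_le_iff simp del: of_nat_power)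
    also have "\<dots> = ?r ^ m"
      by (simp add: power_mult_distrib power_mult)
    finally show "(\<Sum>C\<in>{C. animal v C \<and> card C = m}. (4 * a) ^ card C) \<le> ?r ^ m" .
  qed
  also have "\<dots> = (\<Sum>v\<in>B. \<Sum>m=n..<n + Suc (card \<Lambda>). ?r ^ m)"
    by (rule sum.cartesian_product[symmetric])
  also have "\<dots> \<le> (\<Sum>v\<in>B. 2 * ?r ^ n)"
    using a r by (intro sum_mono sum_power_tail_le) auto
  also have "\<dots> = 2 * real (card B) * ?r ^ n" by simp
  finally show ?thesis .
qed

end

section \<open>Measures on the spin space and the DLR equations\<close>

definition marg :: "('v \<Rightarrow> bool) measure \<Rightarrow> 'v set \<Rightarrow> ('v \<Rightarrow> bool) \<Rightarrow> real" where
  "marg \<nu> J \<xi> = measure \<nu> (cyl J \<xi>)"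

definition depends_on :: "'v set \<Rightarrow> (('v \<Rightarrow> bool) \<Rightarrow> 'a) \<Rightarrow> bool" where
  "depends_on J h \<longleftrightarrow> (\<forall>\<eta> \<eta>'. (\<forall>x\<in>J. \<eta> x = \<eta>' x) \<longrightarrow> h \<eta> = h \<eta>')"

lemma depends_onD: "depends_on J h \<Longrightarrow> (\<And>x. x \<in> J \<Longrightarrow> \<eta> x = \<eta>' x) \<Longrightarrow> h \<eta> = h \<eta>'"
  unfolding depends_on_def by (elim allE[of _ \<eta>] allE[of _ \<eta>']) simp

lemma space_spin_space [simp]: "space spin_space = UNIV"
  by (simp add: spin_space_def space_PiM)

lemma cyl_in_sets [measurable]:
  assumes "finite J"
  shows "cyl J \<xi> \<in> sets spin_space"
proof -
  have "{\<eta> \<in> space spin_space. \<forall>x\<in>J. \<eta> x = \<xi> x} \<in> sets spin_space"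
    unfolding spin_space_def using assms by measurable
  then show ?thesis by (simp add: cyl_def)
qed

lemma depends_on_decompose:
  assumes "depends_on J (\<lambda>\<eta>. \<eta> \<in> S)"
  shows "S = (\<Union>\<zeta>\<in>local_configs J \<omega> \<inter> S. cyl J \<zeta>)"
proof -
  have "\<eta> \<in> S \<longleftrightarrow> \<eta>' \<in> S" if "\<And>x. x \<in> J \<Longrightarrow> \<eta> x = \<eta>' x" for \<eta> \<eta>'
    using depends_onD[OF assms that] .
  note S = this
  show ?thesis
  proof (intro equalityI subsetI)
    fix \<eta> assume "\<eta> \<in> S"
    then have "graft J \<eta> \<omega> \<in> local_configs J \<omega> \<inter> S"
      using S[of \<eta> "graft J \<eta> \<omega>"] graft_in_local_configs[of J \<eta> \<omega>] by (simp add: graft_apply)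
    moreover have "\<eta> \<in> cyl J (graft J \<eta> \<omega>)" by (simp add: cyl_def graft_apply)
    ultimately show "\<eta> \<in> (\<Union>\<zeta>\<in>local_configs J \<omega> \<inter> S. cyl J \<zeta>)" by blast
  next
    fix \<eta> assume "\<eta> \<in> (\<Union>\<zeta>\<in>local_configs J \<omega> \<inter> S. cyl J \<zeta>)"
    then obtain \<zeta> where "\<zeta> \<in> S" "\<eta> \<in> cyl J \<zeta>" by blast
    then show "\<eta> \<in> S" using S[of \<eta> \<zeta>] by (simp add: cyl_def)
  qed
qed

lemma depends_on_sets:
  assumes "depends_on J (\<lambda>\<eta>. \<eta> \<in> S)" "finite J"
  shows "S \<in> sets spin_space"
  using assms finite_local_configs[OF assms(2), of undefined]
  by (subst depends_on_decompose[OF assms(1), of undefined]) (auto intro!: sets.finite_UN)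

lemma depends_on_measurable:
  assumes "depends_on J h" "finite J" "\<And>\<eta>. h \<eta> \<in> space N"
  shows "h \<in> spin_space \<rightarrow>\<^sub>M N"
proof (rule measurableI)
  fix A
  have "depends_on J (\<lambda>\<eta>. \<eta> \<in> h -` A)"
    unfolding depends_on_def using depends_onD[OF assms(1)] by (metis vimage_eq)
  from depends_on_sets[OF this assms(2)] show "h -` A \<inter> space spin_space \<in> sets spin_space"
    by simp
qed (use assms(3) in simp)

lemma cyl_disjoint:
  "disjoint_family_on (cyl J) (local_configs K \<xi>)" if "K \<subseteq> J"
  unfolding disjoint_family_on_def
proof (intro ballI impI)
  fix \<zeta> \<zeta>' assume *: "\<zeta> \<in> local_configs K \<xi>" "\<zeta>' \<in> local_configs K \<xi>" "\<zeta> \<noteq> \<zeta>'"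
  then obtain x where "\<zeta> x \<noteq> \<zeta>' x" by blast
  moreover from this have "x \<in> K" using * by (auto simp: local_configs_iff)
  ultimately show "cyl J \<zeta> \<inter> cyl J \<zeta>' = {}" using that by (auto simp: cyl_def)
qed

lemma measure_depends_on:
  assumes "prob_space \<nu>" "sets \<nu> = sets spin_space" "depends_on J (\<lambda>\<eta>. \<eta> \<in> S)" "finite J"
  shows "measure \<nu> S = (\<Sum>\<zeta>\<in>local_configs J \<omega> \<inter> S. marg \<nu> J \<zeta>)"
proof -
  interpret prob_space \<nu> by fact
  have disj: "disjoint_family_on (cyl J) (local_configs J \<omega> \<inter> S)"
    by (rule disjoint_family_on_mono[OF _ cyl_disjoint[of J J \<omega>]]) auto
  have fin: "finite (local_configs J \<omega> \<inter> S)" using finite_local_configs[OF assms(4)] by blast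
  have sub: "cyl J ` (local_configs J \<omega> \<inter> S) \<subseteq> sets \<nu>"
    unfolding assms(2) using cyl_in_sets[OF assms(4)] by (simp add: image_subset_iff)
  have "measure \<nu> S = measure \<nu> (\<Union>\<zeta>\<in>local_configs J \<omega> \<inter> S. cyl J \<zeta>)"
    by (rule arg_cong[OF depends_on_decompose[OF assms(3)]])
  also have "\<dots> = (\<Sum>\<zeta>\<in>local_configs J \<omega> \<inter> S. marg \<nu> J \<zeta>)"
    unfolding marg_def by (rule finite_measure_finite_Union[OF fin sub disj])
  finally show ?thesis .
qed

lemma consistent_marg:
  assumes "prob_space \<nu>" "sets \<nu> = sets spin_space"
  shows "consistent (marg \<nu>)"
  unfolding consistent_def
proof (intro conjI allI impI)
  interpret prob_space \<nu> by fact
  have sp: "space \<nu> = UNIV" using sets_eq_imp_space_eq[OF assms(2)] by simp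
  show "0 \<le> marg \<nu> J \<xi>" for J \<xi> by (simp add: marg_def)
  show "marg \<nu> {} \<xi> = 1" for \<xi> using prob_space sp by (simp add: marg_def cyl_def)
  show "marg \<nu> J \<xi> = marg \<nu> J \<xi>'" if "\<forall>x\<in>J. \<xi> x = \<xi>' x" for J \<xi> \<xi>'
    using that by (simp add: marg_def cyl_def)
  fix J K :: "'a set" and \<xi> assume J: "finite J" "K \<subseteq> J"
  have "cyl (J - K) \<xi> = (\<Union>\<zeta>\<in>local_configs K \<xi>. cyl J \<zeta>)"
  proof (intro equalityI subsetI)
    fix \<eta> assume "\<eta> \<in> cyl (J - K) \<xi>"
    then have "\<eta> \<in> cyl J (graft K \<eta> \<xi>)" by (auto simp: cyl_def graft_apply)
    then show "\<eta> \<in> (\<Union>\<zeta>\<in>local_configs K \<xi>. cyl J \<zeta>)" using graft_in_local_configs by blast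
  next
    fix \<eta> assume "\<eta> \<in> (\<Union>\<zeta>\<in>local_configs K \<xi>. cyl J \<zeta>)"
    then obtain \<zeta> where "\<zeta> \<in> local_configs K \<xi>" "\<eta> \<in> cyl J \<zeta>" by blast
    then show "\<eta> \<in> cyl (J - K) \<xi>" by (simp add: cyl_def local_configs_iff)
  qed
  moreover have fin: "finite (local_configs K \<xi>)"
    using finite_subset[OF J(2,1)] by (rule finite_local_configs)
  moreover have sub: "cyl J ` local_configs K \<xi> \<subseteq> sets \<nu>"
    unfolding assms(2) using cyl_in_sets[OF J(1)] by (simp add: image_subset_iff)
  ultimately show "marg \<nu> (J - K) \<xi> = (\<Sum>\<zeta>\<in>local_configs K \<xi>. marg \<nu> J \<zeta>)"
    unfolding marg_def using finite_measure_finite_Union[OF fin sub cyl_disjoint[OF J(2)]] by simp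
qed

text \<open>Windows may be restricted to those containing a fixed \<open>J0\<close>, because any
  window can be enlarged. This matters for the DLR equation in \<open>K\<close>, which is evaluated
  explicitly only on windows containing \<open>nbhd K\<close>.\<close>

lemma spin_measure_eqI:
  assumes \<mu>: "prob_space \<mu>" "sets \<mu> = sets spin_space" and \<nu>: "prob_space \<nu>" "sets \<nu> = sets spin_space"
    and J0: "finite J0"
    and eq: "\<And>J \<xi>. finite J \<Longrightarrow> J0 \<subseteq> J \<Longrightarrow> marg \<mu> J \<xi> = marg \<nu> J \<xi>"
  shows "\<mu> = \<nu>"
proof (rule measure_eqI_PiM_infinite)
  interpret M: prob_space \<mu> by fact
  interpret N: prob_space \<nu> by fact
  show "sets \<mu> = sets (Pi\<^sub>M UNIV (\<lambda>_. count_space UNIV))" "sets \<nu> = sets (Pi\<^sub>M UNIV (\<lambda>_. count_space UNIV))"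
    using \<mu> \<nu> by (simp_all add: spin_space_def)
  show "finite_measure \<mu>" by unfold_locales
  fix A :: "'a \<Rightarrow> bool set" and J :: "'a set" assume J: "finite J"
  let ?S = "prod_emb UNIV (\<lambda>_. count_space UNIV) J (Pi\<^sub>E J A)"
  have S: "\<eta> \<in> ?S \<longleftrightarrow> (\<forall>j\<in>J. \<eta> j \<in> A j)" for \<eta> by (auto simp: prod_emb_def PiE_iff)
  have dep: "depends_on (J \<union> J0) (\<lambda>\<eta>. \<eta> \<in> ?S)" unfolding depends_on_def S by auto
  have fin: "finite (J \<union> J0)" using J J0 by simp
  have "measure \<mu> ?S = measure \<nu> ?S"
    unfolding measure_depends_on[OF \<mu> dep fin, of undefined] measure_depends_on[OF \<nu> dep fin, of undefined]
    using fin by (intro sum.cong refl eq) auto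
  then show "emeasure \<mu> ?S = emeasure \<nu> ?S"
    by (simp add: M.emeasure_eq_measure N.emeasure_eq_measure)
qed

text \<open>Local events as an intersection-stable generator: the measurability of the Gibbs kernel
  needs to be checked only on them.\<close>

lemma sets_spin_space_generated:
  "sets spin_space = sigma_sets UNIV {S. \<exists>J. finite J \<and> depends_on J (\<lambda>\<eta>. \<eta> \<in> S)}" (is "_ = sigma_sets _ ?G")
proof (intro equalityI)
  show "sigma_sets UNIV ?G \<subseteq> sets spin_space"
    using depends_on_sets by (intro sets.sigma_sets_subset[of _ spin_space, simplified]) blast
  have "prod_algebra UNIV (\<lambda>_. count_space UNIV) \<subseteq> ?G"
  proof
    fix S :: "('a \<Rightarrow> bool) set" assume "S \<in> prod_algebra UNIV (\<lambda>_. count_space UNIV)"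
    then obtain J E where JE: "S = prod_emb UNIV (\<lambda>_. count_space UNIV) J (Pi\<^sub>E J E)" "finite J"
      by (rule prod_algebraE) blast
    then have "\<eta> \<in> S \<longleftrightarrow> (\<forall>j\<in>J. \<eta> j \<in> E j)" for \<eta> by (auto simp: prod_emb_def PiE_iff)
    then have "depends_on J (\<lambda>\<eta>. \<eta> \<in> S)" by (simp add: depends_on_def)
    then show "S \<in> ?G" using JE by blast
  qed
  then have "sigma_sets UNIV (prod_algebra UNIV (\<lambda>_. count_space UNIV)) \<subseteq> sigma_sets UNIV ?G"
    by (rule sigma_sets_mono')
  then show "sets spin_space \<subseteq> sigma_sets UNIV ?G" by (simp add: spin_space_def sets_PiM)
qed

lemma Int_stable_depends_on: "Int_stable {S. \<exists>J. finite J \<and> depends_on J (\<lambda>\<eta>. \<eta> \<in> S)}"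
proof (rule Int_stableI, clarify)
  fix A B :: "('a \<Rightarrow> bool) set" and J J'
  assume A: "finite J" "depends_on J (\<lambda>\<eta>. \<eta> \<in> A)" and B: "finite J'" "depends_on J' (\<lambda>\<eta>. \<eta> \<in> B)"
  have "depends_on (J \<union> J') (\<lambda>\<eta>. \<eta> \<in> A \<inter> B)"
    unfolding depends_on_def
  proof (intro allI impI)
    fix \<eta> \<eta>' assume "\<forall>x\<in>J \<union> J'. \<eta> x = (\<eta>' x :: bool)"
    then show "(\<eta> \<in> A \<inter> B) = (\<eta>' \<in> A \<inter> B)"
      using depends_onD[OF A(2), of \<eta> \<eta>'] depends_onD[OF B(2), of \<eta> \<eta>'] by simp
  qed
  then show "\<exists>J. finite J \<and> depends_on J (\<lambda>\<eta>. \<eta> \<in> A \<inter> B)" using A B by (intro exI[of _ "J \<union> J'"]) simp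
qed

section \<open>Finite-volume Gibbs measures as finite sums\<close>

context bounded_degree_graph
begin

definition weight :: "real \<Rightarrow> 'v set \<Rightarrow> ('v \<Rightarrow> bool) \<Rightarrow> real" where
  "weight \<beta> K \<eta> = exp (- \<beta> * real (energy K \<eta>))"

lemma weight_pos: "0 < weight \<beta> K \<eta>"
  by (simp add: weight_def)

lemma weight_cong: "(\<And>x. x \<in> nbhd K \<Longrightarrow> \<eta> x = \<eta>' x) \<Longrightarrow> weight \<beta> K \<eta> = weight \<beta> K \<eta>'"
  unfolding weight_def
  by (intro arg_cong[where f="\<lambda>n. exp (- \<beta> * real n)"] hamiltonian_cong) (use subset_nbhd in blast)+

lemma gibbs_weight_eq: "\<eta> \<in> local_configs K \<omega> \<Longrightarrow> gibbs_weight \<beta> adj K \<omega> \<eta> = weight \<beta> K \<eta>"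
  using hamiltonian_cong[of K \<eta> \<eta> \<omega> \<eta>] by (simp add: gibbs_weight_def weight_def local_configs_iff)

abbreviation part_fun :: "real \<Rightarrow> 'v set \<Rightarrow> ('v \<Rightarrow> bool) \<Rightarrow> real" where
  "part_fun \<beta> K \<omega> \<equiv> \<Sum>\<eta>\<in>local_configs K \<omega>. weight \<beta> K \<eta>"

lemma partition_function_eq: "partition_function \<beta> adj K \<omega> = part_fun \<beta> K \<omega>"
  by (simp add: partition_function_def gibbs_weight_eq)

lemma part_fun_pos: "finite K \<Longrightarrow> 0 < part_fun \<beta> K \<omega>"
  using finite_local_configs[of K \<omega>] weight_pos
  by (intro sum_pos) (auto simp: local_configs_iff intro!: exI[of _ \<omega>])

lemma part_fun_cong:
  assumes "\<And>x. x \<in> nbhd K \<Longrightarrow> x \<notin> K \<Longrightarrow> \<omega> x = \<omega>' x"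
  shows "part_fun \<beta> K \<omega> = part_fun \<beta> K \<omega>'"
proof (rule sum.reindex_bij_witness[of _ "\<lambda>\<eta>. graft K \<eta> \<omega>" "\<lambda>\<eta>. graft K \<eta> \<omega>'"])
  fix \<eta> assume "\<eta> \<in> local_configs K \<omega>"
  then show "graft K (graft K \<eta> \<omega>') \<omega> = \<eta>" "weight \<beta> K (graft K \<eta> \<omega>') = weight \<beta> K \<eta>"
    using assms by (simp add: local_configs_iff graft_apply fun_eq_iff,
        intro weight_cong, simp add: local_configs_iff graft_apply)
next
  fix \<eta> assume "\<eta> \<in> local_configs K \<omega>'"
  then show "graft K (graft K \<eta> \<omega>) \<omega>' = \<eta>"
    by (simp add: local_configs_iff graft_apply fun_eq_iff)
qed (auto intro: graft_in_local_configs)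

lemma sets_finite_gibbs [simp]: "sets (finite_gibbs \<beta> adj K \<omega>) = sets spin_space"
  by (simp add: finite_gibbs_def)

lemma emeasure_finite_gibbs:
  assumes "finite K" "A \<in> sets spin_space"
  shows "emeasure (finite_gibbs \<beta> adj K \<omega>) A =
    ennreal ((\<Sum>\<eta>\<in>local_configs K \<omega> \<inter> A. weight \<beta> K \<eta>) / part_fun \<beta> K \<omega>)"
proof -
  let ?f = "\<lambda>\<eta>. gibbs_weight \<beta> adj K \<omega> \<eta> / partition_function \<beta> adj K \<omega>"
  have pos: "0 < part_fun \<beta> K \<omega>" by (rule part_fun_pos[OF assms(1)])
  have fin: "finite (local_configs K \<omega>)" using assms finite_local_configs by blast
  have "emeasure (finite_gibbs \<beta> adj K \<omega>) A = emeasure (density (count_space UNIV) (\<lambda>\<eta>. ennreal (?f \<eta>))) A"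
    unfolding finite_gibbs_def using assms(2) by (subst emeasure_distr) (auto simp: measurable_def)
  also have "\<dots> = (\<integral>\<^sup>+\<eta>. ennreal (?f \<eta>) * indicator A \<eta> \<partial>count_space UNIV)"
    by (rule emeasure_density) auto
  \<comment> \<open>The density vanishes off the finite set \<open>local_configs K \<omega>\<close>,
    so the integral over all configurations is a finite sum.\<close>
  also have "\<dots> = (\<Sum>\<eta>\<in>local_configs K \<omega> \<inter> A. ennreal (?f \<eta>) * indicator A \<eta>)"
    using fin by (intro nn_integral_count_space') (auto simp: gibbs_weight_def)
  also have "\<dots> = (\<Sum>\<eta>\<in>local_configs K \<omega> \<inter> A. ennreal (weight \<beta> K \<eta> / part_fun \<beta> K \<omega>))"
    by (intro sum.cong refl) (auto simp: gibbs_weight_eq partition_function_eq)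
  also have "\<dots> = ennreal (\<Sum>\<eta>\<in>local_configs K \<omega> \<inter> A. weight \<beta> K \<eta> / part_fun \<beta> K \<omega>)"
    using pos by (intro sum_ennreal divide_nonneg_pos less_imp_le[OF weight_pos])
  finally show ?thesis by (simp add: sum_divide_distrib)
qed

lemma prob_space_finite_gibbs:
  assumes "finite K"
  shows "prob_space (finite_gibbs \<beta> adj K \<omega>)"
proof
  have "space (finite_gibbs \<beta> adj K \<omega>) = UNIV" by (simp add: finite_gibbs_def)
  then show "emeasure (finite_gibbs \<beta> adj K \<omega>) (space (finite_gibbs \<beta> adj K \<omega>)) = 1"
    using emeasure_finite_gibbs[OF assms, of UNIV \<beta> \<omega>] part_fun_pos[OF assms, of \<beta> \<omega>]
      sets.top[of spin_space] by simp
qed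

lemma marg_finite_gibbs:
  assumes "finite K" "finite J"
  shows "marg (finite_gibbs \<beta> adj K \<omega>) J \<xi> =
    (\<Sum>\<eta>\<in>local_configs K \<omega> \<inter> cyl J \<xi>. weight \<beta> K \<eta>) / part_fun \<beta> K \<omega>"
  unfolding marg_def measure_def
  using emeasure_finite_gibbs[OF assms(1) cyl_in_sets[OF assms(2)]] part_fun_pos[OF assms(1), of \<beta> \<omega>]
  by (simp add: sum_nonneg less_imp_le[OF weight_pos])

lemma consistent_finite_gibbs: "finite K \<Longrightarrow> consistent (marg (finite_gibbs \<beta> adj K \<omega>))"
  by (simp add: consistent_marg prob_space_finite_gibbs)

lemma frozen_finite_gibbs:
  assumes "finite K" "K \<subseteq> \<Lambda>"
  shows "frozen_outside \<omega> \<Lambda> (marg (finite_gibbs \<beta> adj K \<omega>))"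
  unfolding frozen_outside_def
proof (intro allI impI)
  fix J \<xi> x assume *: "finite J" "x \<in> J" "x \<notin> \<Lambda>" "\<xi> x \<noteq> \<omega> x"
  have False if "\<eta> \<in> local_configs K \<omega>" "\<eta> \<in> cyl J \<xi>" for \<eta>
  proof -
    have "x \<notin> K" using * assms(2) by blast
    then have "\<eta> x = \<omega> x" "\<eta> x = \<xi> x"
      using that *(2) unfolding local_configs_iff cyl_def by blast+
    then show False using * by simp
  qed
  then have "local_configs K \<omega> \<inter> cyl J \<xi> = {}" by blast
  with * show "marg (finite_gibbs \<beta> adj K \<omega>) J \<xi> = 0"
    using marg_finite_gibbs[OF assms(1)] by simp
qed

text \<open>The Hamiltonian counts inner edges as unordered and boundary edges as ordered pairs. A
  boundary pair has only its first vertex in \<open>K\<close>, so forgetting the order is injective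
  and one set of edges remains.\<close>

lemma energy_eq_card_frustrated:
  assumes "finite K"
  shows "energy K \<eta> = card {{v, w} | v w. adj v w \<and> v \<in> K \<and> \<eta> v \<noteq> \<eta> w}"
proof -
  let ?I = "{{v, w} | v w. adj v w \<and> v \<in> K \<and> w \<in> K \<and> \<eta> v \<noteq> \<eta> w}"
  let ?X = "{(v, u). adj v u \<and> v \<in> K \<and> u \<notin> K \<and> \<eta> v \<noteq> \<eta> u}"
  let ?e = "\<lambda>(v, u). {v, u}"
  have "?I \<subseteq> Pow K" by auto
  then have finI: "finite ?I" using assms by (meson finite_Pow_iff finite_subset)
  have "?X \<subseteq> nbhd K \<times> nbhd K" by (auto simp: nbhd_def)
  then have finX: "finite ?X" using finite_nbhd[OF assms] by (meson finite_SigmaI finite_subset)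
  have inj: "inj_on ?e ?X" by (auto simp: inj_on_def doubleton_eq_iff)
  have "{{v, w} | v w. adj v w \<and> v \<in> K \<and> \<eta> v \<noteq> \<eta> w} = ?I \<union> ?e ` ?X"
  proof (intro equalityI subsetI)
    fix e assume "e \<in> {{v, w} | v w. adj v w \<and> v \<in> K \<and> \<eta> v \<noteq> \<eta> w}"
    then obtain v w where e: "e = {v, w}" "adj v w" "v \<in> K" "\<eta> v \<noteq> \<eta> w" by blast
    show "e \<in> ?I \<union> ?e ` ?X"
    proof (cases "w \<in> K")
      case False
      then have "(v, w) \<in> ?X" using e by simp
      then show ?thesis using e by force
    qed (use e in blast)
  qed auto
  moreover have "?I \<inter> ?e ` ?X = {}"
    by (auto simp: doubleton_eq_iff)
  ultimately show ?thesis
    using finI finX card_image[OF inj] by (simp add: hamiltonian_def card_Un_disjoint)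
qed

text \<open>Edges meeting \<Lambda> either meet \<open>K\<close> or avoid it; the count of the
  latter does not involve the spins in \<open>K\<close>.\<close>

lemma energy_split:
  assumes "finite \<Lambda>" "K \<subseteq> \<Lambda>"
  shows "energy \<Lambda> \<eta> = energy K \<eta> +
    card {{v, w} | v w. adj v w \<and> v \<in> \<Lambda> \<and> v \<notin> K \<and> w \<notin> K \<and> \<eta> v \<noteq> \<eta> w}"
proof -
  let ?E = "\<lambda>K. {{v, w} | v w. adj v w \<and> v \<in> K \<and> \<eta> v \<noteq> \<eta> w}"
  let ?R = "{{v, w} | v w. adj v w \<and> v \<in> \<Lambda> \<and> v \<notin> K \<and> w \<notin> K \<and> \<eta> v \<noteq> \<eta> w}"
  have "?E \<Lambda> \<subseteq> Pow (nbhd \<Lambda>)" by (auto simp: nbhd_def)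
  then have fin: "finite (?E \<Lambda>)" using finite_nbhd[OF assms(1)] by (meson finite_Pow_iff finite_subset)
  have un: "?E \<Lambda> = ?E K \<union> ?R"
  proof (intro equalityI subsetI)
    fix e assume "e \<in> ?E \<Lambda>"
    then obtain v w where e: "e = {v, w}" "adj v w" "v \<in> \<Lambda>" "\<eta> v \<noteq> \<eta> w" by blast
    have e': "e = {w, v}" "adj w v" "\<eta> w \<noteq> \<eta> v" using e adj_sym by auto
    show "e \<in> ?E K \<union> ?R"
      using e e' by (cases "v \<in> K"; cases "w \<in> K") blast+
  qed (use assms in blast)
  moreover have "?E K \<inter> ?R = {}" by (auto simp: doubleton_eq_iff)
  ultimately have "card (?E \<Lambda>) = card (?E K) + card ?R"
    using fin by (metis (no_types, lifting) card_Un_disjoint finite_Un)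
  then show ?thesis
    by (simp only: energy_eq_card_frustrated[OF assms(1)]
        energy_eq_card_frustrated[OF finite_subset[OF assms(2,1)]])
qed

text \<open>Rewriting the spins in \<open>K\<close> changes the energies of \<Lambda> and of
  \<open>K\<close> by the same amount. Replacing \<xi> by \<xi>' on \<open>K\<close> is a bijection
  between the configurations compatible with the two cylinders, and \<open>key\<close> matches the
  sums term by term.\<close>

lemma balanced_finite_gibbs:
  assumes \<Lambda>: "finite \<Lambda>" and K: "K \<subseteq> \<Lambda>"
  shows "balanced \<beta> (marg (finite_gibbs \<beta> adj \<Lambda> \<omega>)) K"
  unfolding balanced_def
proof (intro allI impI)
  fix J \<xi> \<xi>' assume J: "finite J" "nbhd K \<subseteq> J" and off: "\<forall>x. x \<notin> K \<longrightarrow> \<xi> x = (\<xi>' x :: bool)"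
  have KJ: "K \<subseteq> J" using J subset_nbhd by blast
  have key: "weight \<beta> \<Lambda> (graft K \<xi>' \<eta>) * weight \<beta> K \<xi> = weight \<beta> \<Lambda> \<eta> * weight \<beta> K \<xi>'"
    if \<eta>: "\<eta> \<in> cyl J \<xi>" and off: "\<forall>x. x \<notin> K \<longrightarrow> \<xi> x = (\<xi>' x :: bool)" for \<eta> \<xi> \<xi>'
  proof -
    let ?\<eta> = "graft K \<xi>' \<eta>"
    have "{{v, w} | v w. adj v w \<and> v \<in> \<Lambda> \<and> v \<notin> K \<and> w \<notin> K \<and> ?\<eta> v \<noteq> ?\<eta> w} =
          {{v, w} | v w. adj v w \<and> v \<in> \<Lambda> \<and> v \<notin> K \<and> w \<notin> K \<and> \<eta> v \<noteq> \<eta> w}"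
      by (rule Collect_cong) (auto simp: graft_apply)
    then have "energy \<Lambda> ?\<eta> + energy K \<eta> = energy \<Lambda> \<eta> + energy K ?\<eta>"
      using energy_split[OF \<Lambda> K, of \<eta>] energy_split[OF \<Lambda> K, of ?\<eta>] by simp
    moreover have "energy K \<eta> = energy K \<xi>"
      by (rule hamiltonian_cong) (use \<eta> subsetD[OF J(2)] subsetD[OF KJ] in \<open>simp_all add: cyl_def\<close>)
    moreover have "energy K ?\<eta> = energy K \<xi>'"
      by (rule hamiltonian_cong)
         (use \<eta> subsetD[OF J(2)] subsetD[OF KJ] off in \<open>simp_all add: cyl_def graft_apply\<close>)
    ultimately have "real (energy \<Lambda> ?\<eta>) + real (energy K \<xi>) = real (energy \<Lambda> \<eta>) + real (energy K \<xi>')"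
      by linarith
    then have "- \<beta> * real (energy \<Lambda> ?\<eta>) + - \<beta> * real (energy K \<xi>) = - \<beta> * real (energy \<Lambda> \<eta>) + - \<beta> * real (energy K \<xi>')"
      unfolding distrib_left[symmetric] by (simp only:)
    then show ?thesis unfolding weight_def exp_add[symmetric] by (rule arg_cong)
  qed
  have "(\<Sum>\<eta>\<in>local_configs \<Lambda> \<omega> \<inter> cyl J \<xi>. weight \<beta> \<Lambda> \<eta> * weight \<beta> K \<xi>') =
        (\<Sum>\<eta>\<in>local_configs \<Lambda> \<omega> \<inter> cyl J \<xi>'. weight \<beta> \<Lambda> \<eta> * weight \<beta> K \<xi>)"
  proof (rule sum.reindex_bij_witness[of _ "graft K \<xi>" "graft K \<xi>'"])
    fix \<eta> assume "\<eta> \<in> local_configs \<Lambda> \<omega> \<inter> cyl J \<xi>"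
    then show "graft K \<xi> (graft K \<xi>' \<eta>) = \<eta>" "graft K \<xi>' \<eta> \<in> local_configs \<Lambda> \<omega> \<inter> cyl J \<xi>'"
      "weight \<beta> \<Lambda> (graft K \<xi>' \<eta>) * weight \<beta> K \<xi> = weight \<beta> \<Lambda> \<eta> * weight \<beta> K \<xi>'"
      using subsetD[OF K] subsetD[OF KJ] off key[of \<eta> \<xi> \<xi>']
      by (auto simp only: Int_iff local_configs_iff cyl_def graft_apply fun_eq_iff mem_Collect_eq if_True if_False split: if_split)
  next
    fix \<eta> assume "\<eta> \<in> local_configs \<Lambda> \<omega> \<inter> cyl J \<xi>'"
    then show "graft K \<xi>' (graft K \<xi> \<eta>) = \<eta>" "graft K \<xi> \<eta> \<in> local_configs \<Lambda> \<omega> \<inter> cyl J \<xi>"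
      using subsetD[OF K] subsetD[OF KJ] off
      by (auto simp only: Int_iff local_configs_iff cyl_def graft_apply fun_eq_iff mem_Collect_eq split: if_split)
  qed
  then show "marg (finite_gibbs \<beta> adj \<Lambda> \<omega>) J \<xi> * exp (- \<beta> * real (energy K \<xi>')) =
      marg (finite_gibbs \<beta> adj \<Lambda> \<omega>) J \<xi>' * exp (- \<beta> * real (energy K \<xi>))"
    unfolding marg_finite_gibbs[OF \<Lambda> J(1)] weight_def[symmetric] by (simp add: sum_distrib_right)
qed

end

section \<open>The Gibbs kernel and the DLR equations in terms of marginals\<close>

context bounded_degree_graph
begin

lemma finite_gibbs_emeasure_cong:
  assumes K: "finite K" and J: "finite J" "depends_on J (\<lambda>\<eta>. \<eta> \<in> A)"
    and eq: "\<And>x. x \<in> J \<union> nbhd K \<Longrightarrow> \<omega> x = \<omega>' x"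
  shows "emeasure (finite_gibbs \<beta> adj K \<omega>) A = emeasure (finite_gibbs \<beta> adj K \<omega>') A"
proof -
  have sets: "A \<in> sets spin_space" using depends_on_sets[OF J(2,1)] .
  have *: "graft K (graft K \<eta> \<omega>') \<omega> = \<eta> \<and> graft K \<eta> \<omega>' \<in> local_configs K \<omega>' \<inter> A \<and>
      weight \<beta> K (graft K \<eta> \<omega>') = weight \<beta> K \<eta>"
    if \<eta>: "\<eta> \<in> local_configs K \<omega> \<inter> A" and eq: "\<And>x. x \<in> J \<union> nbhd K \<Longrightarrow> \<omega> x = \<omega>' x" for \<omega> \<omega>' \<eta>
  proof -
    have off: "\<eta> x = \<omega> x" if "x \<notin> K" for x using \<eta> that by (simp add: local_configs_iff)
    have agree: "graft K \<eta> \<omega>' x = \<eta> x" if "x \<in> J \<union> nbhd K" for x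
      using off[of x] eq[OF that] by (simp add: graft_apply)
    have "graft K (graft K \<eta> \<omega>') \<omega> x = \<eta> x" for x using off[of x] by (simp add: graft_apply)
    moreover have "graft K \<eta> \<omega>' \<in> A \<longleftrightarrow> \<eta> \<in> A"
      by (rule depends_onD[OF J(2)]) (rule agree, simp)
    moreover have "weight \<beta> K (graft K \<eta> \<omega>') = weight \<beta> K \<eta>"
      by (rule weight_cong) (rule agree, simp)
    ultimately show ?thesis using \<eta> graft_in_local_configs[of K \<eta> \<omega>'] by blast
  qed
  have "(\<Sum>\<eta>\<in>local_configs K \<omega> \<inter> A. weight \<beta> K \<eta>) = (\<Sum>\<eta>\<in>local_configs K \<omega>' \<inter> A. weight \<beta> K \<eta>)"
    by (rule sum.reindex_bij_witness[of _ "\<lambda>\<eta>. graft K \<eta> \<omega>" "\<lambda>\<eta>. graft K \<eta> \<omega>'"])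
       (use *[of _ \<omega> \<omega>'] *[of _ \<omega>' \<omega>] eq in \<open>simp_all add: eq\<close>)
  moreover have "part_fun \<beta> K \<omega> = part_fun \<beta> K \<omega>'"
    by (rule part_fun_cong) (rule eq, simp)
  ultimately show ?thesis by (simp only: emeasure_finite_gibbs[OF K sets])
qed

text \<open>The kernel probability of a local event is a function of finitely many boundary spins,
  hence measurable.\<close>

lemma finite_gibbs_kernel:
  assumes K: "finite K"
  shows "finite_gibbs \<beta> adj K \<in> spin_space \<rightarrow>\<^sub>M prob_algebra spin_space"
proof (rule measurable_prob_algebra_generated[OF sets_spin_space_generated Int_stable_depends_on])
  fix A :: "('v \<Rightarrow> bool) set" assume "A \<in> {S. \<exists>J. finite J \<and> depends_on J (\<lambda>\<eta>. \<eta> \<in> S)}"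
  then obtain J where J: "finite J" "depends_on J (\<lambda>\<eta>. \<eta> \<in> A)" by blast
  have "depends_on (J \<union> nbhd K) (\<lambda>\<omega>. emeasure (finite_gibbs \<beta> adj K \<omega>) A)"
    unfolding depends_on_def by (intro allI impI finite_gibbs_emeasure_cong[OF K J]) blast
  then show "(\<lambda>\<omega>. emeasure (finite_gibbs \<beta> adj K \<omega>) A) \<in> borel_measurable spin_space"
    by (rule depends_on_measurable) (simp_all add: J finite_nbhd[OF K])
qed (simp_all add: prob_space_finite_gibbs K)

text \<open>The window determines all spins around \<open>K\<close>, so the integrand is a constant
  times the indicator that the boundary condition matches \<xi> on \<open>J - K\<close>: if it
  matches, exactly one filling of \<open>K\<close> lies in the cylinder, otherwise none.\<close>

lemma nn_integral_finite_gibbs_cyl: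
  assumes \<mu>: "prob_space \<mu>" "sets \<mu> = sets spin_space"
    and K: "finite K" and J: "finite J" "nbhd K \<subseteq> J"
  shows "(\<integral>\<^sup>+\<omega>. emeasure (finite_gibbs \<beta> adj K \<omega>) (cyl J \<xi>) \<partial>\<mu>) =
    ennreal (marg \<mu> (J - K) \<xi> * (weight \<beta> K \<xi> / part_fun \<beta> K \<xi>))"
proof -
  interpret prob_space \<mu> by fact
  let ?g = "weight \<beta> K \<xi> / part_fun \<beta> K \<xi>"
  have g: "0 \<le> ?g" using part_fun_pos[OF K, of \<beta> \<xi>] less_imp_le[OF weight_pos[of \<beta> K \<xi>]] by simp
  have eq: "emeasure (finite_gibbs \<beta> adj K \<omega>) (cyl J \<xi>) = ennreal ?g * indicator (cyl (J - K) \<xi>) \<omega>" for \<omega>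
  proof (cases "\<omega> \<in> cyl (J - K) \<xi>")
    case True
    then have \<omega>: "\<omega> x = \<xi> x" if "x \<in> J" "x \<notin> K" for x using that by (simp add: cyl_def)
    have "\<eta> \<in> local_configs K \<omega> \<inter> cyl J \<xi> \<longleftrightarrow> \<eta> = graft K \<xi> \<omega>" for \<eta>
    proof
      assume \<eta>: "\<eta> \<in> local_configs K \<omega> \<inter> cyl J \<xi>"
      show "\<eta> = graft K \<xi> \<omega>"
      proof
        fix x show "\<eta> x = graft K \<xi> \<omega> x"
          using \<eta> subset_nbhd[of K] J by (cases "x \<in> K") (auto simp only: graft_apply cyl_def local_configs_iff Int_iff mem_Collect_eq if_True if_False)
      qed
    next
      assume "\<eta> = graft K \<xi> \<omega>"
      then show "\<eta> \<in> local_configs K \<omega> \<inter> cyl J \<xi>"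
        using \<omega> by (simp add: graft_in_local_configs cyl_def graft_apply)
    qed
    then have "local_configs K \<omega> \<inter> cyl J \<xi> = {graft K \<xi> \<omega>}" by blast
    moreover have "weight \<beta> K (graft K \<xi> \<omega>) = weight \<beta> K \<xi>"
      by (rule weight_cong) (use \<omega> subsetD[OF J(2)] in \<open>simp add: graft_apply\<close>)
    moreover have "part_fun \<beta> K \<omega> = part_fun \<beta> K \<xi>"
      by (rule part_fun_cong) (use \<omega> subsetD[OF J(2)] in simp)
    ultimately show ?thesis
      using True by (simp add: emeasure_finite_gibbs[OF K cyl_in_sets[OF J(1)]])
  next
    case False
    then obtain x where x: "x \<in> J" "x \<notin> K" "\<omega> x \<noteq> \<xi> x" by (auto simp: cyl_def)
    have "\<not> (\<eta> \<in> local_configs K \<omega> \<and> \<eta> \<in> cyl J \<xi>)" for \<eta>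
    proof
      assume \<eta>: "\<eta> \<in> local_configs K \<omega> \<and> \<eta> \<in> cyl J \<xi>"
      have "\<eta> x = \<omega> x" "\<eta> x = \<xi> x" using \<eta> x(1,2) unfolding local_configs_iff cyl_def by blast+
      then show False using x(3) by simp
    qed
    then have "local_configs K \<omega> \<inter> cyl J \<xi> = {}" by blast
    then show ?thesis using False by (simp add: emeasure_finite_gibbs[OF K cyl_in_sets[OF J(1)]])
  qed
  have "cyl (J - K) \<xi> \<in> sets \<mu>" using \<mu>(2) J by (simp add: cyl_in_sets)
  then have "(\<integral>\<^sup>+\<omega>. emeasure (finite_gibbs \<beta> adj K \<omega>) (cyl J \<xi>) \<partial>\<mu>) = ennreal ?g * emeasure \<mu> (cyl (J - K) \<xi>)"
    unfolding eq by (rule nn_integral_cmult_indicator)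
  also have "\<dots> = ennreal (marg \<mu> (J - K) \<xi> * ?g)"
    unfolding emeasure_eq_measure marg_def
    by (subst ennreal_mult'[symmetric, OF g]) (simp only: mult.commute)
  finally show ?thesis .
qed

text \<open>Summing the balance relation over all fillings of \<open>K\<close> restores the
  normalisation and yields the conditional law given the outside.\<close>

lemma balanced_part_fun:
  assumes p: "consistent p" and K: "balanced \<beta> p K" and J: "finite J" "nbhd K \<subseteq> J"
  shows "p (J - K) \<xi> * weight \<beta> K \<xi> = p J \<xi> * part_fun \<beta> K \<xi>"
proof -
  have KJ: "K \<subseteq> J" using J subset_nbhd by blast
  have "p (J - K) \<xi> * weight \<beta> K \<xi> = (\<Sum>\<zeta>\<in>local_configs K \<xi>. p J \<zeta> * weight \<beta> K \<xi>)"
    by (simp add: consistent_sum[OF p J(1) KJ] sum_distrib_right)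
  also have "\<dots> = (\<Sum>\<zeta>\<in>local_configs K \<xi>. p J \<xi> * weight \<beta> K \<zeta>)"
    unfolding weight_def
    by (intro sum.cong refl K[unfolded balanced_def, rule_format, OF J]) (simp add: local_configs_iff)
  finally show ?thesis by (simp add: sum_distrib_left)
qed

text \<open>Forward, the DLR equation is evaluated on cylinders, where the outer marginal and the
  partition function are the same for \<xi> and \<xi>'. Backward, \<mu> and its image under the
  kernel agree on all cylinders over windows containing \<open>nbhd K\<close>, hence
  coincide.\<close>

lemma gibbs_measures_iff_balanced:
  assumes \<mu>: "prob_space \<mu>" "sets \<mu> = sets spin_space"
  shows "\<mu> \<in> gibbs_measures \<beta> adj \<longleftrightarrow> (\<forall>K. finite K \<longrightarrow> balanced \<beta> (marg \<mu>) K)"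
proof
  interpret prob_space \<mu> by fact
  assume G: "\<mu> \<in> gibbs_measures \<beta> adj"
  show "\<forall>K. finite K \<longrightarrow> balanced \<beta> (marg \<mu>) K"
    unfolding balanced_def
  proof (intro allI impI)
    fix K J \<xi> \<xi>' assume K: "finite K" and J: "finite J" "nbhd K \<subseteq> J" and off: "\<forall>x. x \<notin> K \<longrightarrow> \<xi> x = (\<xi>' x :: bool)"
    have m: "marg \<mu> J \<zeta> = marg \<mu> (J - K) \<zeta> * (weight \<beta> K \<zeta> / part_fun \<beta> K \<zeta>)" for \<zeta>
    proof -
      have "ennreal (marg \<mu> J \<zeta>) = (\<integral>\<^sup>+\<omega>. emeasure (finite_gibbs \<beta> adj K \<omega>) (cyl J \<zeta>) \<partial>\<mu>)"
        using G K cyl_in_sets[OF J(1)] unfolding gibbs_measures_def marg_def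
        by (simp add: emeasure_eq_measure[symmetric])
      also have "\<dots> = ennreal (marg \<mu> (J - K) \<zeta> * (weight \<beta> K \<zeta> / part_fun \<beta> K \<zeta>))"
        by (rule nn_integral_finite_gibbs_cyl[OF \<mu> K J])
      finally show ?thesis
        using part_fun_pos[OF K, of \<beta> \<zeta>] less_imp_le[OF weight_pos[of \<beta> K \<zeta>]]
        by (subst (asm) ennreal_inj) (auto simp: marg_def)
    qed
    have "local_configs K \<xi> = local_configs K \<xi>'" using off by (simp add: local_configs_def)
    moreover have "marg \<mu> (J - K) \<xi> = marg \<mu> (J - K) \<xi>'" using off by (simp add: marg_def cyl_def)
    ultimately show "marg \<mu> J \<xi> * exp (- \<beta> * real (energy K \<xi>')) = marg \<mu> J \<xi>' * exp (- \<beta> * real (energy K \<xi>))"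
      unfolding weight_def[symmetric] m[of \<xi>] m[of \<xi>'] by simp
  qed
next
  interpret prob_space \<mu> by fact
  assume bal: "\<forall>K. finite K \<longrightarrow> balanced \<beta> (marg \<mu>) K"
  have cons: "consistent (marg \<mu>)" by (rule consistent_marg[OF \<mu>])
  have "emeasure \<mu> A = (\<integral>\<^sup>+ \<omega>. emeasure (finite_gibbs \<beta> adj K \<omega>) A \<partial>\<mu>)"
    if K: "finite K" and A: "A \<in> sets spin_space" for K A
  proof -
    have "finite_gibbs \<beta> adj K \<in> \<mu> \<rightarrow>\<^sub>M prob_algebra spin_space"
      using finite_gibbs_kernel[OF K] measurable_cong_sets[OF \<mu>(2) refl] by blast
    then have ker: "finite_gibbs \<beta> adj K \<in> \<mu> \<rightarrow>\<^sub>M subprob_algebra spin_space"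
      by (rule measurable_prob_algebraD)
    let ?\<nu> = "\<mu> \<bind> finite_gibbs \<beta> adj K"
    have em: "emeasure ?\<nu> A = (\<integral>\<^sup>+ \<omega>. emeasure (finite_gibbs \<beta> adj K \<omega>) A \<partial>\<mu>)"
      if "A \<in> sets spin_space" for A
      by (rule emeasure_bind[OF not_empty ker that])
    have \<nu>: "prob_space ?\<nu>" "sets ?\<nu> = sets spin_space"
      by (rule prob_space_bind[OF _ ker], simp add: prob_space_finite_gibbs[OF K])
         (rule sets_bind[OF sets_finite_gibbs not_empty])
    interpret N: prob_space ?\<nu> by fact
    have "\<mu> = ?\<nu>"
    proof (rule spin_measure_eqI[OF \<mu> \<nu> finite_nbhd[OF K]])
      fix J \<xi> assume J: "finite J" "nbhd K \<subseteq> J"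
      have pos: "0 < part_fun \<beta> K \<xi>" by (rule part_fun_pos[OF K])
      have "ennreal (marg ?\<nu> J \<xi>) = ennreal (marg \<mu> (J - K) \<xi> * (weight \<beta> K \<xi> / part_fun \<beta> K \<xi>))"
        using em[OF cyl_in_sets[OF J(1)], of \<xi>]
        unfolding nn_integral_finite_gibbs_cyl[OF \<mu> K J] N.emeasure_eq_measure marg_def[of ?\<nu>] .
      also have "marg \<mu> (J - K) \<xi> * (weight \<beta> K \<xi> / part_fun \<beta> K \<xi>) = marg \<mu> J \<xi>"
        using balanced_part_fun[OF cons bal[rule_format, OF K] J, of \<xi>] pos by (simp add: field_simps)
      finally show "marg \<mu> J \<xi> = marg ?\<nu> J \<xi>"
        by (subst (asm) ennreal_inj) (auto simp: marg_def)
    qed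
    then show ?thesis using em[OF A] by simp
  qed
  then show "\<mu> \<in> gibbs_measures \<beta> adj" using \<mu> by (simp add: gibbs_measures_def)
qed

end

section \<open>Weak convergence and existence of the limit\<close>

lemma openin_cyl:
  assumes "finite J"
  shows "openin spin_topology (cyl J \<xi>)"
proof -
  have "cyl J \<xi> = (\<Pi>\<^sub>E x\<in>UNIV. if x \<in> J then {\<xi> x} else UNIV)"
  proof -
    have "(\<eta> \<in> cyl J \<xi>) = (\<forall>x. \<eta> x \<in> (if x \<in> J then {\<xi> x} else UNIV))" for \<eta>
      unfolding cyl_def mem_Collect_eq Ball_def by (rule arg_cong[where f=All]) (simp add: fun_eq_iff)
    moreover have "(\<eta> \<in> (\<Pi>\<^sub>E x\<in>UNIV. X x)) = (\<forall>x. \<eta> x \<in> X x)" for \<eta> and X :: "'a \<Rightarrow> bool set"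
      by (simp add: PiE_iff)
    ultimately show ?thesis by (intro set_eqI) (simp only:)
  qed
  moreover have "{x. (if x \<in> J then {\<xi> x} else UNIV) \<noteq> (UNIV::bool set)} \<subseteq> J" by auto
  then have "finite {x. (if x \<in> J then {\<xi> x} else UNIV) \<noteq> (UNIV::bool set)}"
    using assms finite_subset by blast
  ultimately show ?thesis
    unfolding spin_topology_def by (simp add: product_topology_basis)
qed

lemma topspace_spin_topology [simp]: "topspace spin_topology = UNIV"
  by (simp add: spin_topology_def PiE_UNIV_domain)

lemma depends_on_continuous:
  assumes "depends_on J h" "finite J"
  shows "continuous_map spin_topology euclideanreal h"
  unfolding continuous_map_def
proof (intro conjI allI impI)
  fix U assume "openin euclideanreal U"
  have "depends_on J (\<lambda>\<eta>. \<eta> \<in> h -` U)"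
    unfolding depends_on_def using depends_onD[OF assms(1)] by (metis vimage_eq)
  then have "h -` U = (\<Union>\<zeta>\<in>local_configs J undefined \<inter> h -` U. cyl J \<zeta>)"
    by (rule depends_on_decompose)
  moreover have "openin spin_topology (\<Union>\<zeta>\<in>local_configs J undefined \<inter> h -` U. cyl J \<zeta>)"
    using openin_cyl[OF assms(2)] by (intro openin_Union) blast
  ultimately show "openin spin_topology {x \<in> topspace spin_topology. h x \<in> U}"
    by (simp add: vimage_def)
qed simp

lemma open_contains_cyl:
  assumes "openin spin_topology U" "\<eta> \<in> U"
  shows "\<exists>J. finite J \<and> cyl J \<eta> \<subseteq> U"
proof -
  obtain X where X: "\<eta> \<in> (\<Pi>\<^sub>E x\<in>UNIV. X x)" "finite {x. X x \<noteq> topspace (discrete_topology (UNIV::bool set))}" "(\<Pi>\<^sub>E x\<in>UNIV. X x) \<subseteq> U"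
    using product_topology_open_contains_basis[OF assms(1)[unfolded spin_topology_def] assms(2)] by auto
  let ?J = "{x. X x \<noteq> UNIV}"
  have "cyl ?J \<eta> \<subseteq> (\<Pi>\<^sub>E x\<in>UNIV. X x)"
  proof
    fix \<zeta> assume \<zeta>: "\<zeta> \<in> cyl ?J \<eta>"
    have "\<zeta> x \<in> X x" for x
    proof (cases "X x = UNIV")
      case False
      then have "\<zeta> x = \<eta> x" using \<zeta> by (simp add: cyl_def)
      then show ?thesis using X(1) by (auto simp: PiE_iff)
    qed simp
    then show "\<zeta> \<in> (\<Pi>\<^sub>E x\<in>UNIV. X x)" by (simp add: PiE_iff)
  qed
  then show ?thesis using X by (intro exI[of _ ?J]) auto
qed

text \<open>Uniform continuity by compactness: finitely many cylinders with oscillation control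
  cover the space, and \<open>J\<close> is the union of their windows. The half e/2 is used twice,
  to go through the value at the centre of a common cylinder.\<close>

lemma continuous_almost_local:
  assumes f: "continuous_map spin_topology euclideanreal f" and e: "0 < e"
  obtains J where "finite J" "\<And>\<eta> \<eta>'. (\<And>x. x \<in> J \<Longrightarrow> \<eta> x = \<eta>' x) \<Longrightarrow> \<bar>f \<eta> - f \<eta>'\<bar> < e"
proof -
  have "\<exists>J. finite J \<and> (\<forall>\<zeta>\<in>cyl J \<eta>. \<bar>f \<zeta> - f \<eta>\<bar> < e / 2)" for \<eta>
  proof -
    have "openin spin_topology {\<zeta> \<in> topspace spin_topology. f \<zeta> \<in> ball (f \<eta>) (e / 2)}"
      by (rule openin_continuous_map_preimage[OF f]) simp
    moreover have "\<eta> \<in> {\<zeta> \<in> topspace spin_topology. f \<zeta> \<in> ball (f \<eta>) (e / 2)}" using e by simp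
    ultimately obtain J where "finite J" "cyl J \<eta> \<subseteq> {\<zeta> \<in> topspace spin_topology. f \<zeta> \<in> ball (f \<eta>) (e / 2)}"
      using open_contains_cyl by blast
    then show ?thesis by (intro exI[of _ J]) (auto simp: dist_real_def abs_minus_commute)
  qed
  then obtain j where j: "\<And>\<eta>. finite (j \<eta>)" "\<And>\<eta> \<zeta>. \<zeta> \<in> cyl (j \<eta>) \<eta> \<Longrightarrow> \<bar>f \<zeta> - f \<eta>\<bar> < e / 2" by metis
  have "compact_space (spin_topology :: ('a \<Rightarrow> bool) topology)"
    unfolding spin_topology_def compact_space_product_topology
    by (simp add: compact_space_discrete_topology)
  then have "\<exists>\<F>. finite \<F> \<and> \<F> \<subseteq> (\<lambda>\<eta>. cyl (j \<eta>) \<eta>) ` UNIV \<and> topspace spin_topology \<subseteq> \<Union>\<F>"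
    unfolding compact_space_def
    by (rule compactinD) (use openin_cyl j(1) in \<open>auto simp: cyl_def\<close>)
  then obtain \<F> where \<F>: "finite \<F>" "\<F> \<subseteq> (\<lambda>\<eta>. cyl (j \<eta>) \<eta>) ` UNIV" "UNIV \<subseteq> \<Union>\<F>"
    by auto
  obtain T where T: "finite T" "\<F> = (\<lambda>\<eta>. cyl (j \<eta>) \<eta>) ` T"
    using finite_subset_image[OF \<F>(1,2)] by auto
  show thesis
  proof
    show "finite (\<Union>\<eta>\<in>T. j \<eta>)" using T j by simp
    fix \<eta> \<eta>' :: "'a \<Rightarrow> bool" assume eq: "\<And>x. x \<in> (\<Union>\<eta>\<in>T. j \<eta>) \<Longrightarrow> \<eta> x = \<eta>' x"
    obtain \<tau> where \<tau>: "\<tau> \<in> T" "\<eta> \<in> cyl (j \<tau>) \<tau>" using \<F>(3) T(2) by blast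
    have "\<eta>' \<in> cyl (j \<tau>) \<tau>" unfolding cyl_def
    proof (intro CollectI ballI)
      fix x assume x: "x \<in> j \<tau>"
      then have "\<eta> x = \<tau> x" using \<tau>(2) by (simp add: cyl_def)
      moreover have "\<eta> x = \<eta>' x" using x \<tau>(1) by (intro eq) blast
      ultimately show "\<eta>' x = \<tau> x" by simp
    qed
    then show "\<bar>f \<eta> - f \<eta>'\<bar> < e" using j(2)[OF \<tau>(2)] j(2)[of \<eta>' \<tau>] by linarith
  qed
qed

text \<open>The product sigma-algebra is not identified with the Borel sets of the product topology,
  as the vertex type is arbitrary here. Instead \<open>f\<close> is a limit of functions of finitely
  many spins.\<close>

lemma continuous_spin_measurable:
  assumes "continuous_map spin_topology euclideanreal f"
  shows "f \<in> borel_measurable spin_space"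
proof -
  have "\<exists>J. finite J \<and> (\<forall>\<eta>. \<bar>f (graft J \<eta> undefined) - f \<eta>\<bar> < 1 / real (Suc n))" for n
  proof -
    obtain J where "finite J" "\<And>\<eta> \<eta>'. (\<And>x. x \<in> J \<Longrightarrow> \<eta> x = \<eta>' x) \<Longrightarrow> \<bar>f \<eta> - f \<eta>'\<bar> < 1 / real (Suc n)"
      using continuous_almost_local[OF assms, of "1 / real (Suc n)"] by auto
    then show ?thesis by (intro exI[of _ J]) (simp add: graft_apply)
  qed
  then obtain J where J: "\<And>n. finite (J n)" "\<And>n \<eta>. \<bar>f (graft (J n) \<eta> undefined) - f \<eta>\<bar> < 1 / real (Suc n)"
    by metis
  show ?thesis
  proof (rule borel_measurable_LIMSEQ_metric[of "\<lambda>n \<eta>. f (graft (J n) \<eta> undefined)"])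
    fix n
    have "graft (J n) \<eta> undefined = graft (J n) \<eta>' undefined" if "\<forall>x\<in>J n. \<eta> x = \<eta>' x" for \<eta> \<eta>'
      using that by (simp add: fun_eq_iff graft_apply)
    then have "depends_on (J n) (\<lambda>\<eta>. f (graft (J n) \<eta> undefined))"
      unfolding depends_on_def by metis
    then show "(\<lambda>\<eta>. f (graft (J n) \<eta> undefined)) \<in> borel_measurable spin_space"
      by (rule depends_on_measurable) (simp_all add: J(1))
  next
    fix \<eta> :: "'a \<Rightarrow> bool"
    show "(\<lambda>n. f (graft (J n) \<eta> undefined)) \<longlonglongrightarrow> f \<eta>"
      by (rule LIM_zero_cancel, rule Lim_null_comparison[OF _ LIMSEQ_inverse_real_of_nat])
         (intro always_eventually allI, use less_imp_le[OF J(2)] in \<open>simp add: inverse_eq_divide\<close>)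
  qed
qed

lemma integral_depends_on:
  fixes h :: "('v \<Rightarrow> bool) \<Rightarrow> real"
  assumes \<nu>: "prob_space \<nu>" "sets \<nu> = sets spin_space" and J: "finite J"
  shows "integrable \<nu> (\<lambda>\<eta>. h (graft J \<eta> \<omega>))"
    and "integral\<^sup>L \<nu> (\<lambda>\<eta>. h (graft J \<eta> \<omega>)) = (\<Sum>\<zeta>\<in>local_configs J \<omega>. h \<zeta> * marg \<nu> J \<zeta>)"
proof -
  interpret prob_space \<nu> by fact
  have fin: "finite (local_configs J \<omega>)" using J by (rule finite_local_configs)
  have eq: "h (graft J \<eta> \<omega>) = (\<Sum>\<zeta>\<in>local_configs J \<omega>. h \<zeta> * indicator (cyl J \<zeta>) \<eta>)" for \<eta>
  proof -
    have "\<eta> \<in> cyl J \<zeta> \<longleftrightarrow> \<zeta> = graft J \<eta> \<omega>" if "\<zeta> \<in> local_configs J \<omega>" for \<zeta>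
    proof
      assume \<eta>: "\<eta> \<in> cyl J \<zeta>"
      show "\<zeta> = graft J \<eta> \<omega>"
      proof
        fix x show "\<zeta> x = graft J \<eta> \<omega> x"
          using \<eta> that by (cases "x \<in> J") (simp_all add: cyl_def local_configs_iff graft_apply)
      qed
    qed (simp add: cyl_def graft_apply)
    then have "(\<Sum>\<zeta>\<in>local_configs J \<omega>. h \<zeta> * indicator (cyl J \<zeta>) \<eta>) =
        (\<Sum>\<zeta>\<in>local_configs J \<omega>. if \<zeta> = graft J \<eta> \<omega> then h \<zeta> else 0)"
      by (intro sum.cong refl) (simp add: indicator_def)
    also have "\<dots> = h (graft J \<eta> \<omega>)"
      using fin graft_in_local_configs[of J \<eta> \<omega>] by simp
    finally show ?thesis by simp
  qed
  have meas: "cyl J \<zeta> \<in> sets \<nu>" for \<zeta> using \<nu>(2) J by (simp add: cyl_in_sets)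
  show "integrable \<nu> (\<lambda>\<eta>. h (graft J \<eta> \<omega>))"
    unfolding eq using meas by (intro Bochner_Integration.integrable_sum integrable_mult_right integrable_real_indicator) (simp_all add: less_top[symmetric])
  show "integral\<^sup>L \<nu> (\<lambda>\<eta>. h (graft J \<eta> \<omega>)) = (\<Sum>\<zeta>\<in>local_configs J \<omega>. h \<zeta> * marg \<nu> J \<zeta>)"
    unfolding eq using meas
    by (subst Bochner_Integration.integral_sum)
       (auto simp: marg_def less_top[symmetric] intro!: integrable_mult_right integrable_real_indicator)
qed

lemma integral_approx:
  assumes \<nu>: "prob_space \<nu>" "sets \<nu> = sets spin_space"
    and f: "continuous_map spin_topology euclideanreal f" and J: "finite J"
    and e: "\<And>\<eta> \<eta>'. (\<And>x. x \<in> J \<Longrightarrow> \<eta> x = \<eta>' x) \<Longrightarrow> \<bar>f \<eta> - f \<eta>'\<bar> < e"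
  shows "\<bar>integral\<^sup>L \<nu> f - (\<Sum>\<zeta>\<in>local_configs J \<omega>. f \<zeta> * marg \<nu> J \<zeta>)\<bar> \<le> e"
proof -
  interpret prob_space \<nu> by fact
  let ?g = "\<lambda>\<eta>. f (graft J \<eta> \<omega>)"
  note g = integral_depends_on[OF \<nu> J, of f \<omega>]
  have fm: "f \<in> borel_measurable \<nu>"
    using continuous_spin_measurable[OF f] measurable_cong_sets[OF \<nu>(2) refl] by blast
  have d: "\<bar>f \<eta> - ?g \<eta>\<bar> \<le> e" for \<eta>
    by (rule less_imp_le, rule e) (simp add: graft_apply)
  have diff: "integrable \<nu> (\<lambda>\<eta>. f \<eta> - ?g \<eta>)"
    by (rule integrable_const_bound[of _ e]) (use d fm g(1) in auto)
  have fi: "integrable \<nu> f" using Bochner_Integration.integrable_add[OF diff g(1)] by simp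
  have "\<bar>integral\<^sup>L \<nu> f - integral\<^sup>L \<nu> ?g\<bar> = \<bar>\<integral>\<eta>. f \<eta> - ?g \<eta> \<partial>\<nu>\<bar>"
    using fi g(1) by simp
  also have "\<dots> \<le> (\<integral>\<eta>. \<bar>f \<eta> - ?g \<eta>\<bar> \<partial>\<nu>)" by (rule integral_abs_bound)
  also have "\<dots> \<le> (\<integral>\<eta>. e \<partial>\<nu>)"
    using diff d by (intro integral_mono) auto
  also have "\<dots> = e" using prob_space by simp
  finally show ?thesis using g(2) by simp
qed

lemma tendsto_of_approx:
  fixes u :: "'a \<Rightarrow> real"
  assumes "\<And>e. 0 < e \<Longrightarrow> \<exists>u' l'. (u' \<longlongrightarrow> l') F \<and> \<bar>l' - l\<bar> \<le> e \<and> (\<forall>\<^sub>F x in F. \<bar>u x - u' x\<bar> \<le> e)"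
  shows "(u \<longlongrightarrow> l) F"
proof (rule tendstoI)
  fix e :: real assume e: "0 < e"
  \<comment> \<open>Three errors of e/4 are added, which leaves room for the strict
    inequality.\<close>
  then obtain u' l' where *: "(u' \<longlongrightarrow> l') F" "\<bar>l' - l\<bar> \<le> e / 4" "\<forall>\<^sub>F x in F. \<bar>u x - u' x\<bar> \<le> e / 4"
    using assms[of "e / 4"] by auto
  have "\<forall>\<^sub>F x in F. dist (u' x) l' < e / 4" using *(1) e by (intro tendstoD) auto
  with *(3) show "\<forall>\<^sub>F x in F. dist (u x) l < e"
    by eventually_elim (use *(2) e in \<open>unfold dist_real_def, linarith\<close>)
qed

section \<open>Kolmogorov extension for spin systems\<close>

lemma measurable_of_discrete: "of_discrete \<in> borel \<rightarrow>\<^sub>M count_space UNIV"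
  by (rule measurableI) (auto intro: borel_open open_discrete)

text \<open>The projective limit of \<open>polish_projective\<close> is taken over Borel
  sigma-algebras, so spins are moved to the Polish type \<open>bool discrete\<close> by
  \<open>\<phi>\<close> and back by \<open>of_discrete\<close>. Projectivity of the laws
  \<open>P J\<close> is \<open>consistent_transfer\<close> applied to indicators.\<close>

lemma kolmogorov_spin:
  fixes p :: "'v set \<Rightarrow> ('v \<Rightarrow> bool) \<Rightarrow> real"
  assumes p: "consistent p"
  obtains \<nu> where "prob_space \<nu>" "sets \<nu> = sets spin_space" "\<And>J \<xi>. finite J \<Longrightarrow> marg \<nu> J \<xi> = p J \<xi>"
proof -
  define \<omega> :: "'v \<Rightarrow> bool" where "\<omega> = undefined"
  define \<phi> :: "'v set \<Rightarrow> ('v \<Rightarrow> bool) \<Rightarrow> 'v \<Rightarrow> bool discrete"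
    where "\<phi> J \<eta> = restrict (\<lambda>x. discrete (\<eta> x)) J" for J \<eta>
  define N where "N J = point_measure (local_configs J \<omega>) (\<lambda>\<xi>. ennreal (p J \<xi>))" for J
  let ?M = "\<lambda>J :: 'v set. PiM J (\<lambda>_. borel :: bool discrete measure)"
  define P where "P J = distr (N J) (?M J) (\<phi> J)" for J
  have meas: "\<phi> J \<in> N J \<rightarrow>\<^sub>M ?M J" for J
    unfolding N_def measurable_point_measure_eq1 by (simp add: \<phi>_def space_PiM)
  have spN: "space (N J) = local_configs J \<omega>" for J by (simp add: N_def space_point_measure)
  have emN: "emeasure (N J) X = ennreal (\<Sum>\<xi>\<in>X. p J \<xi>)" if "finite J" "X \<subseteq> local_configs J \<omega>" for J X
    unfolding N_def using finite_local_configs[OF that(1), of \<omega>] that(2) consistent_nonneg[OF p]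
    by (subst emeasure_point_measure_finite) (simp_all add: sum_ennreal)
  have emP: "emeasure (P J) X = ennreal (\<Sum>\<xi>\<in>local_configs J \<omega>. p J \<xi> * of_bool (\<phi> J \<xi> \<in> X))"
    if "finite J" "X \<in> sets (?M J)" for J X
  proof -
    have "emeasure (P J) X = emeasure (N J) (\<phi> J -` X \<inter> local_configs J \<omega>)"
      unfolding P_def using emeasure_distr[OF meas that(2)] spN by simp
    also have "\<dots> = ennreal (\<Sum>\<xi>\<in>\<phi> J -` X \<inter> local_configs J \<omega>. p J \<xi>)"
      by (rule emN[OF that(1)]) simp
    also have "(\<Sum>\<xi>\<in>\<phi> J -` X \<inter> local_configs J \<omega>. p J \<xi>) =
        (\<Sum>\<xi>\<in>local_configs J \<omega>. p J \<xi> * of_bool (\<phi> J \<xi> \<in> X))"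
      by (rule sum.mono_neutral_cong_left[OF finite_local_configs[OF that(1)]]) auto
    finally show ?thesis .
  qed
  interpret polish_projective UNIV P
    unfolding polish_projective_def
  proof (rule projective_family.intro)
    fix J H :: "'v set" assume JH: "J \<subseteq> H" "finite H"
    have finJ: "finite J" using JH finite_subset by blast
    have mr: "(\<lambda>f. restrict f J) \<in> P H \<rightarrow>\<^sub>M ?M J"
      unfolding P_def measurable_distr_eq1 using JH(1) by (rule measurable_restrict_subset)
    show "P J = distr (P H) (?M J) (\<lambda>f. restrict f J)"
    proof (rule measure_eqI)
      fix X assume "X \<in> sets (P J)"
      then have X: "X \<in> sets (?M J)" by (simp add: P_def)
      let ?Y = "(\<lambda>f. restrict f J) -` X \<inter> space (P H)"
      have Y: "?Y \<in> sets (?M H)" using measurable_sets[OF mr X] by (simp add: P_def)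
      have \<phi>Y: "\<phi> H \<zeta> \<in> ?Y \<longleftrightarrow> \<phi> J (graft J \<zeta> \<omega>) \<in> X" for \<zeta>
      proof -
        have "restrict (\<phi> H \<zeta>) J = \<phi> J (graft J \<zeta> \<omega>)"
          using JH(1) by (auto simp: \<phi>_def fun_eq_iff graft_apply)
        moreover have "\<phi> H \<zeta> \<in> space (P H)" by (simp add: P_def \<phi>_def space_PiM)
        ultimately show ?thesis by simp
      qed
      have "emeasure (distr (P H) (?M J) (\<lambda>f. restrict f J)) X = emeasure (P H) ?Y"
        by (rule emeasure_distr[OF mr X])
      also have "\<dots> = ennreal (\<Sum>\<zeta>\<in>local_configs H \<omega>. p H \<zeta> * of_bool (\<phi> J (graft J \<zeta> \<omega>) \<in> X))"
        unfolding emP[OF JH(2) Y] \<phi>Y ..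
      also have "\<dots> = emeasure (P J) X"
        unfolding emP[OF finJ X] by (simp only: consistent_transfer[OF p JH(2,1), where \<omega>=\<omega> and h="\<lambda>\<xi>. of_bool (\<phi> J \<xi> \<in> X)"])
      finally show "emeasure (P J) X = emeasure (distr (P H) (?M J) (\<lambda>f. restrict f J)) X" by simp
    qed (simp add: P_def)
  next
    fix J :: "'v set" assume J: "finite J"
    have "emeasure (N J) (space (N J)) = 1"
      unfolding spN using emN[OF J subset_refl] consistent_sum_1[OF p J] by simp
    then have "prob_space (N J)" by (rule prob_spaceI)
    then show "prob_space (P J)" unfolding P_def using meas by (rule prob_space.prob_space_distr)
  qed
  let ?u = "\<lambda>f x. of_discrete (f x)"
  have mu: "?u \<in> lim \<rightarrow>\<^sub>M spin_space"
  proof -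
    have "?u \<in> ?M UNIV \<rightarrow>\<^sub>M spin_space"
      unfolding spin_space_def
      by (rule measurable_abs_UNIV, rule measurable_compose[OF _ measurable_of_discrete]) simp
    then show ?thesis using measurable_cong_sets[OF sets_lim refl] by blast
  qed
  show thesis
  proof
    show "prob_space (distr lim spin_space ?u)" by (rule P.prob_space_distr[OF mu])
    show "sets (distr lim spin_space ?u) = sets spin_space" by simp
    fix J :: "'v set" and \<xi> assume J: "finite J"
    have X: "{\<phi> J \<xi>} \<in> sets (?M J)"
    proof -
      have "\<phi> J \<xi> \<in> extensional J" by (simp add: \<phi>_def)
      from PiE_singleton[OF this] have "{\<phi> J \<xi>} = (\<Pi>\<^sub>E x\<in>J. {\<phi> J \<xi> x})" by simp
      moreover have "(\<Pi>\<^sub>E x\<in>J. {\<phi> J \<xi> x}) \<in> sets (?M J)"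
        using J by (intro sets_PiM_I_finite) auto
      ultimately show ?thesis by simp
    qed
    have iff: "\<phi> J \<zeta> \<in> {\<phi> J \<xi>} \<longleftrightarrow> \<zeta> \<in> cyl J \<xi>" for \<zeta>
      unfolding \<phi>_def cyl_def by (simp add: restrict_def fun_eq_iff discrete_inject) blast
    have "?u -` cyl J \<xi> \<inter> space lim = emb UNIV J {\<phi> J \<xi>}"
    proof (rule set_eqI)
      fix f :: "'v \<Rightarrow> bool discrete"
      have "restrict f J = \<phi> J (\<lambda>x. of_discrete (f x))" by (simp add: \<phi>_def of_discrete_inverse)
      then have "f \<in> emb UNIV J {\<phi> J \<xi>} \<longleftrightarrow> \<phi> J (\<lambda>x. of_discrete (f x)) \<in> {\<phi> J \<xi>}"
        by (simp add: prod_emb_def)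
      then show "f \<in> ?u -` cyl J \<xi> \<inter> space lim \<longleftrightarrow> f \<in> emb UNIV J {\<phi> J \<xi>}"
        unfolding iff by (simp add: space_PiM)
    qed
    then have "emeasure (distr lim spin_space ?u) (cyl J \<xi>) = emeasure lim (emb UNIV J {\<phi> J \<xi>})"
      using emeasure_distr[OF mu cyl_in_sets[OF J]] by simp
    also have "\<dots> = emeasure (P J) {\<phi> J \<xi>}" using J X by (intro emeasure_lim_emb) auto
    also have "\<dots> = ennreal (p J \<xi>)"
      unfolding emP[OF J X] iff consistent_marginal[OF p J subset_refl] ..
    finally show "marg (distr lim spin_space ?u) J \<xi> = p J \<xi>"
      by (simp add: marg_def measure_def consistent_nonneg[OF p])
  qed
qed

context bounded_degree_graph
begin

text \<open>Cylinder indicators are continuous, which gives one direction. For the other,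
  \<open>integral_approx\<close> replaces a continuous function by a local one with an error that is
  the same for all \<Lambda> and for \<mu>.\<close>

lemma weak_limit_gibbs_iff:
  "weak_limit_gibbs \<beta> adj \<omega> \<mu> \<longleftrightarrow> prob_space \<mu> \<and> sets \<mu> = sets spin_space \<and>
     (\<forall>J \<xi>. finite J \<longrightarrow> ((\<lambda>\<Lambda>. marg (finite_gibbs \<beta> adj \<Lambda> \<omega>) J \<xi>) \<longlongrightarrow> marg \<mu> J \<xi>) (finite_subsets_at_top UNIV))"
proof -
  have "(\<forall>f. continuous_map spin_topology euclideanreal f \<longrightarrow>
        ((\<lambda>\<Lambda>. integral\<^sup>L (finite_gibbs \<beta> adj \<Lambda> \<omega>) f) \<longlongrightarrow> integral\<^sup>L \<mu> f) (finite_subsets_at_top UNIV)) \<longleftrightarrow>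
     (\<forall>J \<xi>. finite J \<longrightarrow> ((\<lambda>\<Lambda>. marg (finite_gibbs \<beta> adj \<Lambda> \<omega>) J \<xi>) \<longlongrightarrow> marg \<mu> J \<xi>) (finite_subsets_at_top UNIV))"
    (is "?L \<longleftrightarrow> ?R") if \<mu>: "prob_space \<mu>" "sets \<mu> = sets spin_space"
  proof
    assume L: ?L
    show ?R
    proof (intro allI impI)
      fix J \<xi> assume J: "finite (J :: 'v set)"
      have "depends_on J (indicator (cyl J \<xi>) :: _ \<Rightarrow> real)"
        unfolding depends_on_def by (simp add: indicator_def cyl_def)
      then have c: "continuous_map spin_topology euclideanreal (indicator (cyl J \<xi>))"
        using J by (rule depends_on_continuous)
      have i: "integral\<^sup>L \<nu> (indicator (cyl J \<xi>)) = marg \<nu> J \<xi>" if "sets \<nu> = sets spin_space" for \<nu>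
        using sets_eq_imp_space_eq[OF that] by (simp add: marg_def)
      show "((\<lambda>\<Lambda>. marg (finite_gibbs \<beta> adj \<Lambda> \<omega>) J \<xi>) \<longlongrightarrow> marg \<mu> J \<xi>) (finite_subsets_at_top UNIV)"
        using L[rule_format, OF c] unfolding i[OF \<mu>(2)] i[OF sets_finite_gibbs] .
    qed
  next
    assume R: ?R
    show ?L
    proof (intro allI impI tendsto_of_approx)
      fix f :: "('v \<Rightarrow> bool) \<Rightarrow> real" and e :: real
      assume f: "continuous_map spin_topology euclideanreal f" and e: "0 < e"
      obtain J where J: "finite J" "\<And>\<eta> \<eta>'. (\<And>x. x \<in> J \<Longrightarrow> \<eta> x = \<eta>' x) \<Longrightarrow> \<bar>f \<eta> - f \<eta>'\<bar> < e"
        using continuous_almost_local[OF f e] by auto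
      let ?s = "\<lambda>\<nu>. \<Sum>\<zeta>\<in>local_configs J \<omega>. f \<zeta> * marg \<nu> J \<zeta>"
      have "((\<lambda>\<Lambda>. ?s (finite_gibbs \<beta> adj \<Lambda> \<omega>)) \<longlongrightarrow> ?s \<mu>) (finite_subsets_at_top UNIV)"
        using R J(1) by (intro tendsto_sum tendsto_mult tendsto_const) auto
      moreover have "\<bar>?s \<mu> - integral\<^sup>L \<mu> f\<bar> \<le> e"
        using integral_approx[OF \<mu> f J, of \<omega>] by (simp add: abs_minus_commute)
      moreover have "\<forall>\<^sub>F \<Lambda> in finite_subsets_at_top UNIV.
          \<bar>integral\<^sup>L (finite_gibbs \<beta> adj \<Lambda> \<omega>) f - ?s (finite_gibbs \<beta> adj \<Lambda> \<omega>)\<bar> \<le> e"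
        by (rule eventually_finite_subsets_at_top_weakI)
           (rule integral_approx[OF prob_space_finite_gibbs sets_finite_gibbs f J])
      ultimately show "\<exists>u' l'. (u' \<longlongrightarrow> l') (finite_subsets_at_top UNIV) \<and> \<bar>l' - integral\<^sup>L \<mu> f\<bar> \<le> e \<and>
          (\<forall>\<^sub>F \<Lambda> in finite_subsets_at_top UNIV. \<bar>integral\<^sup>L (finite_gibbs \<beta> adj \<Lambda> \<omega>) f - u' \<Lambda>\<bar> \<le> e)"
        by blast
    qed
  qed
  then show ?thesis unfolding weak_limit_gibbs_def by blast
qed

end

section \<open>Low temperature\<close>

text \<open>\<open>\<kappa>\<close> takes the place of the isoperimetric constant.
  \<open>sparse\<close> makes the price per vertex at most 1, and \<open>low_temperature\<close> is
  the ratio condition of the Peierls sum.\<close>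

locale sparse_ground_state = bounded_degree_graph +
  fixes \<omega> :: "'a \<Rightarrow> bool" and \<beta> \<kappa> :: real and dmax :: nat
  assumes ground_state: "\<omega> \<in> Omega_GS adj dmax"
    and \<beta>_nonneg: "0 \<le> \<beta>"
    and isoperimetry: "finite F \<Longrightarrow> \<kappa> * real (card F) \<le> real (card (edge_boundary adj F))"
    and sparse: "2 * real dmax \<le> \<kappa>"
    and low_temperature: "4 * real deg ^ 2 * exp (- \<beta> * (\<kappa> - 2 * real dmax)) \<le> 1 / 2"
begin

abbreviation fv :: "'a set \<Rightarrow> 'a set \<Rightarrow> ('a \<Rightarrow> bool) \<Rightarrow> real" where
  "fv \<Lambda> \<equiv> marg (finite_gibbs \<beta> adj \<Lambda> \<omega>)"

definition rate :: real where
  "rate = 4 * real deg ^ 2 * exp (- \<beta> * (\<kappa> - 2 * real dmax))"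

lemma rate_nonneg: "0 \<le> rate"
  by (simp add: rate_def)

lemma rate_tendsto_0: "(\<lambda>n. C * rate ^ n) \<longlonglongrightarrow> 0"
  using low_temperature rate_nonneg
  by (intro tendsto_mult_right_zero LIMSEQ_realpow_zero) (auto simp: rate_def)

lemma fv_percolation_le:
  assumes "finite \<Lambda>" "finite \<Delta>" "finite J" "finite B" "reach n B \<subseteq> J"
  shows "percolation_prob \<omega> (fv \<Lambda>) (fv \<Delta>) J n B \<le> 2 * real (card B) * rate ^ n"
proof -
  let ?a = "exp (- \<beta> * (\<kappa> - 2 * real dmax))"
  have sup: "suppressed \<omega> ?a (fv \<Lambda>)" if "finite \<Lambda>" for \<Lambda>
    by (rule suppressed_of_balanced[OF consistent_finite_gibbs[OF that] ground_state \<beta>_nonneg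
          balanced_finite_gibbs[OF that] frozen_finite_gibbs[OF that subset_refl] isoperimetry])
  have "0 \<le> \<beta> * (\<kappa> - 2 * real dmax)" using \<beta>_nonneg sparse by simp
  then have "?a \<le> 1" by simp
  then show ?thesis
    unfolding rate_def using assms low_temperature
    \<comment> \<open>Both copies must be frozen outside one common finite set, although their
      volumes differ.\<close>
    by (intro percolation_prob_le[of _ _ _ _ "\<Lambda> \<union> \<Delta>"] consistent_finite_gibbs sup frozen_finite_gibbs) auto
qed

text \<open>Only volumes inside \<open>reach n B\<close> are swapped, so balance is available as
  soon as both \<Lambda> and \<Delta> contain this set; the bound then depends on \<open>B\<close>
  and \<open>n\<close> alone.\<close>

lemma fv_Cauchy:
  assumes B: "finite B" and n: "1 \<le> n" and \<Lambda>: "finite \<Lambda>" "finite \<Delta>" "reach n B \<subseteq> \<Lambda>" "reach n B \<subseteq> \<Delta>"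
  shows "\<bar>fv \<Lambda> B \<rho> - fv \<Delta> B \<rho>\<bar> \<le> 2 * real (card B) * rate ^ n"
proof -
  let ?J = "B \<union> nbhd (reach n B)"
  have J: "finite ?J" "B \<subseteq> ?J" "nbhd (reach n B) \<subseteq> ?J" using B finite_reach finite_nbhd by auto
  have "\<bar>fv \<Lambda> B \<rho> - fv \<Delta> B \<rho>\<bar> \<le> percolation_prob \<omega> (fv \<Lambda>) (fv \<Delta>) ?J n B"
  proof (rule marginal_diff_le[OF _ _ J n])
    fix K assume "K \<subseteq> reach n B"
    then show "balanced \<beta> (fv \<Lambda>) K \<and> balanced \<beta> (fv \<Delta>) K"
      using balanced_finite_gibbs[OF \<Lambda>(1)] balanced_finite_gibbs[OF \<Lambda>(2)] \<Lambda>(3,4) by (meson order_trans)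
  qed (simp_all add: consistent_finite_gibbs \<Lambda>)
  also have "\<dots> \<le> 2 * real (card B) * rate ^ n"
    using subset_nbhd[of "reach n B"] by (intro fv_percolation_le \<Lambda> J B) auto
  finally show ?thesis .
qed

lemma fv_convergent:
  assumes B: "finite B"
  shows "\<exists>l. ((\<lambda>\<Lambda>. fv \<Lambda> B \<rho>) \<longlongrightarrow> l) (finite_subsets_at_top UNIV)"
proof -
  have "\<exists>P. eventually P (finite_subsets_at_top UNIV) \<and> (\<forall>\<Lambda> \<Delta>. P \<Lambda> \<and> P \<Delta> \<longrightarrow> dist (fv \<Lambda> B \<rho>) (fv \<Delta> B \<rho>) < e)"
    if e: "0 < e" for e
  proof -
    have "\<forall>\<^sub>F n in sequentially. 2 * real (card B) * rate ^ n < e"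
      using order_tendstoD(2)[OF rate_tendsto_0 e] .
    then obtain m where m: "\<And>n. m \<le> n \<Longrightarrow> 2 * real (card B) * rate ^ n < e"
      by (auto simp: eventually_sequentially)
    \<comment> \<open>The swap needs n >= 1, for the truncation of clusters.\<close>
    define n where "n = max 1 m"
    have n: "1 \<le> n" "2 * real (card B) * rate ^ n < e" using m by (auto simp: n_def)
    have "\<forall>\<^sub>F \<Lambda> in finite_subsets_at_top UNIV. finite \<Lambda> \<and> reach n B \<subseteq> \<Lambda>"
      unfolding eventually_finite_subsets_at_top using finite_reach[OF B, of n] by auto
    moreover have "dist (fv \<Lambda> B \<rho>) (fv \<Delta> B \<rho>) < e"
      if "finite \<Lambda> \<and> reach n B \<subseteq> \<Lambda>" "finite \<Delta> \<and> reach n B \<subseteq> \<Delta>" for \<Lambda> \<Delta>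
      using fv_Cauchy[OF B n(1), of \<Lambda> \<Delta> \<rho>] that n(2) by (simp add: dist_real_def)
    ultimately show ?thesis by blast
  qed
  then have "cauchy_filter (filtermap (\<lambda>\<Lambda>. fv \<Lambda> B \<rho>) (finite_subsets_at_top UNIV))"
    unfolding cauchy_filter_metric_filtermap by blast
  from cauchy_filter_complete_converges[OF this complete_UNIV]
  obtain l where "filtermap (\<lambda>\<Lambda>. fv \<Lambda> B \<rho>) (finite_subsets_at_top UNIV) \<le> nhds l"
    by (auto simp: filtermap_bot_iff)
  then show ?thesis unfolding filterlim_def by blast
qed

text \<open>Every consistency condition involves finitely many marginals and is closed, so the
  limits inherit it from the finite-volume families; the extension theorem supplies the
  measure.\<close>

lemma weak_limit_exists: "\<exists>\<mu>. weak_limit_gibbs \<beta> adj \<omega> \<mu>"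
proof -
  let ?F = "finite_subsets_at_top (UNIV :: 'a set)"
  have "\<forall>J \<xi>. \<exists>l. finite J \<longrightarrow> ((\<lambda>\<Lambda>. fv \<Lambda> J \<xi>) \<longlongrightarrow> l) ?F" using fv_convergent by blast
  then obtain l where l: "\<And>J \<xi>. finite J \<Longrightarrow> ((\<lambda>\<Lambda>. fv \<Lambda> J \<xi>) \<longlongrightarrow> l J \<xi>) ?F" by metis
  \<comment> \<open>Positivity and independence of outside values are demanded for all
    \<open>J\<close>; the default 0 settles infinite windows, where no limit was obtained.\<close>
  define p where "p J \<xi> = (if finite J then l J \<xi> else 0)" for J \<xi>
  have lim: "((\<lambda>\<Lambda>. fv \<Lambda> J \<xi>) \<longlongrightarrow> p J \<xi>) ?F" if "finite J" for J \<xi>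
    using l[OF that] that by (simp add: p_def)
  have ev: "eventually P ?F" if "\<And>\<Lambda>. finite \<Lambda> \<Longrightarrow> P \<Lambda>" for P
    using that by (rule eventually_finite_subsets_at_top_weakI)
  have "consistent p"
    unfolding consistent_def
  proof (intro conjI allI impI)
    show "0 \<le> p J \<xi>" for J \<xi>
    proof (cases "finite J")
      case True
      then show ?thesis by (intro tendsto_lowerbound[OF lim]) (auto simp: marg_def)
    qed (simp add: p_def)
    show "p {} \<xi> = 1" for \<xi>
      by (rule tendsto_unique[OF _ lim], simp, simp, rule tendsto_eventually, rule ev)
         (rule consistent_empty[OF consistent_finite_gibbs])
    show "p J \<xi> = p J \<xi>'" if eq: "\<forall>x\<in>J. \<xi> x = \<xi>' x" for J \<xi> \<xi>'
    proof (cases "finite J")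
      case True
      have "cyl J \<xi> = cyl J \<xi>'" using eq by (simp add: cyl_def)
      then have "((\<lambda>\<Lambda>. fv \<Lambda> J \<xi>) \<longlongrightarrow> p J \<xi>') ?F" using lim[OF True, of \<xi>'] by (simp add: marg_def)
      then show ?thesis using tendsto_unique[OF _ lim[OF True]] by simp
    qed (simp add: p_def)
    fix J K \<xi> assume J: "finite (J :: 'a set)" "K \<subseteq> J"
    have "((\<lambda>\<Lambda>. \<Sum>\<zeta>\<in>local_configs K \<xi>. fv \<Lambda> J \<zeta>) \<longlongrightarrow> (\<Sum>\<zeta>\<in>local_configs K \<xi>. p J \<zeta>)) ?F"
      by (intro tendsto_sum lim J)
    moreover have "\<forall>\<^sub>F \<Lambda> in ?F. (\<Sum>\<zeta>\<in>local_configs K \<xi>. fv \<Lambda> J \<zeta>) = fv \<Lambda> (J - K) \<xi>"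
      by (rule ev) (rule consistent_sum[OF consistent_finite_gibbs J, symmetric])
    ultimately have "((\<lambda>\<Lambda>. fv \<Lambda> (J - K) \<xi>) \<longlongrightarrow> (\<Sum>\<zeta>\<in>local_configs K \<xi>. p J \<zeta>)) ?F"
      using tendsto_cong by fastforce
    then show "p (J - K) \<xi> = (\<Sum>\<zeta>\<in>local_configs K \<xi>. p J \<zeta>)"
      using tendsto_unique[OF _ lim] J by simp
  qed
  then obtain \<nu> where "prob_space \<nu>" "sets \<nu> = sets spin_space" "\<And>J \<xi>. finite J \<Longrightarrow> marg \<nu> J \<xi> = p J \<xi>"
    using kolmogorov_spin by blast
  then have "weak_limit_gibbs \<beta> adj \<omega> \<nu>" using lim by (simp add: weak_limit_gibbs_iff)
  then show ?thesis ..
qed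

text \<open>No percolation bound is known for \<nu> itself, but t\<nu> <= \<mu> allows the copy with
  law \<nu> to be replaced by one with law \<mu>. For the pair (\<mu>, \<mu>) the finite-volume
  bound passes to the limit; then n tends to infinity with \<open>t\<close> and \<open>B\<close>
  fixed.\<close>

lemma weak_limit_unique_component:
  assumes \<mu>: "weak_limit_gibbs \<beta> adj \<omega> \<mu>" and bal\<mu>: "\<And>K. finite K \<Longrightarrow> balanced \<beta> (marg \<mu>) K"
    and \<nu>: "\<nu> \<in> gibbs_measures \<beta> adj" and t: "0 < t"
    and dom: "\<And>A. A \<in> sets spin_space \<Longrightarrow> t * measure \<nu> A \<le> measure \<mu> A"
  shows "\<nu> = \<mu>"
proof -
  let ?F = "finite_subsets_at_top (UNIV :: 'a set)"
  have \<mu>': "prob_space \<mu>" "sets \<mu> = sets spin_space"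
    "\<And>J \<xi>. finite J \<Longrightarrow> ((\<lambda>\<Lambda>. fv \<Lambda> J \<xi>) \<longlongrightarrow> marg \<mu> J \<xi>) ?F"
    using \<mu> by (simp_all add: weak_limit_gibbs_iff)
  have \<nu>': "prob_space \<nu>" "sets \<nu> = sets spin_space" using \<nu> by (simp_all add: gibbs_measures_def)
  note cons = consistent_marg[OF \<mu>'(1,2)] consistent_marg[OF \<nu>']
  have bal\<nu>: "balanced \<beta> (marg \<nu>) K" if "finite K" for K
    using \<nu> that gibbs_measures_iff_balanced[OF \<nu>'] by blast
  have bound: "t * \<bar>marg \<nu> B \<rho> - marg \<mu> B \<rho>\<bar> \<le> 2 * real (card B) * rate ^ n" if B: "finite B" and n: "1 \<le> n" for B n \<rho>
  proof -
    let ?J = "B \<union> nbhd (reach n B)"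
    let ?b = "\<lambda>\<xi> \<xi>'. of_bool (percolates n B (disagreement \<omega> \<xi> \<xi>')) :: real"
    have J: "finite ?J" "B \<subseteq> ?J" "nbhd (reach n B) \<subseteq> ?J" using B finite_reach finite_nbhd by auto
    have "\<bar>marg \<nu> B \<rho> - marg \<mu> B \<rho>\<bar> \<le> percolation_prob \<omega> (marg \<nu>) (marg \<mu>) ?J n B"
    proof (rule marginal_diff_le[OF cons(2,1) J n])
      fix K assume "K \<subseteq> reach n B"
      then have "finite K" using finite_reach[OF B] finite_subset by blast
      then show "balanced \<beta> (marg \<nu>) K \<and> balanced \<beta> (marg \<mu>) K" using bal\<mu> bal\<nu> by blast
    qed
    then have "t * \<bar>marg \<nu> B \<rho> - marg \<mu> B \<rho>\<bar> \<le> t * percolation_prob \<omega> (marg \<nu>) (marg \<mu>) ?J n B"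
      using t by simp
    also have "\<dots> = (\<Sum>\<xi>\<in>local_configs ?J \<omega>. \<Sum>\<xi>'\<in>local_configs ?J \<omega>. t * marg \<nu> ?J \<xi> * marg \<mu> ?J \<xi>' * ?b \<xi> \<xi>')"
      by (simp only: percolation_prob_def sum_distrib_left mult.assoc)
    also have "\<dots> \<le> percolation_prob \<omega> (marg \<mu>) (marg \<mu>) ?J n B"
      unfolding percolation_prob_def
    proof (intro sum_mono mult_right_mono)
      show "t * marg \<nu> ?J \<xi> \<le> marg \<mu> ?J \<xi>" for \<xi>
        unfolding marg_def by (rule dom[OF cyl_in_sets[OF J(1)]])
    qed (simp_all add: marg_def)
    also have "\<dots> \<le> 2 * real (card B) * rate ^ n"
    proof (rule tendsto_upperbound)
      \<comment> \<open>For a fixed window this is a finite sum of products of marginals, so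
        convergence of marginals suffices.\<close>
      show "((\<lambda>\<Lambda>. percolation_prob \<omega> (fv \<Lambda>) (fv \<Lambda>) ?J n B) \<longlongrightarrow> percolation_prob \<omega> (marg \<mu>) (marg \<mu>) ?J n B) ?F"
        unfolding percolation_prob_def by (intro tendsto_sum tendsto_mult tendsto_const \<mu>'(3) J)
      show "\<forall>\<^sub>F \<Lambda> in ?F. percolation_prob \<omega> (fv \<Lambda>) (fv \<Lambda>) ?J n B \<le> 2 * real (card B) * rate ^ n"
        using subset_nbhd[of "reach n B"]
        by (intro eventually_finite_subsets_at_top_weakI fv_percolation_le J B) auto
    qed simp
    finally show ?thesis .
  qed
  have "marg \<nu> B \<rho> = marg \<mu> B \<rho>" if B: "finite B" for B \<rho>
  proof -
    have "t * \<bar>marg \<nu> B \<rho> - marg \<mu> B \<rho>\<bar> \<le> 0"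
      by (rule LIMSEQ_le_const[OF rate_tendsto_0[of "2 * real (card B)"]]) (use bound[OF B] in blast)
    then show ?thesis using t by (simp add: mult_le_0_iff)
  qed
  then show ?thesis
    by (intro spin_measure_eqI[OF \<nu>' \<mu>'(1,2), of "{}"]) auto
qed

text \<open>For fixed \<open>K\<close> the balance relation holds as soon as \<Lambda> contains
  \<open>K\<close>, and it survives the limit, so \<mu> is Gibbs. In a convex combination both
  components are dominated by \<mu>, with factors \<open>t\<close> and \<open>1 - t\<close>, and
  hence equal it.\<close>

lemma weak_limit_extremal:
  assumes \<mu>: "weak_limit_gibbs \<beta> adj \<omega> \<mu>"
  shows "extremal_gibbs \<beta> adj \<mu>"
proof -
  let ?F = "finite_subsets_at_top (UNIV :: 'a set)"
  have \<mu>': "prob_space \<mu>" "sets \<mu> = sets spin_space"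
    "\<And>J \<xi>. finite J \<Longrightarrow> ((\<lambda>\<Lambda>. fv \<Lambda> J \<xi>) \<longlongrightarrow> marg \<mu> J \<xi>) ?F"
    using \<mu> by (simp_all add: weak_limit_gibbs_iff)
  have bal: "balanced \<beta> (marg \<mu>) K" if K: "finite K" for K
    unfolding balanced_def
  proof (intro allI impI)
    fix J \<xi> \<xi>' assume J: "finite J" "nbhd K \<subseteq> J" and off: "\<forall>x. x \<notin> K \<longrightarrow> \<xi> x = (\<xi>' x :: bool)"
    let ?w = "\<lambda>\<xi>. exp (- \<beta> * real (energy K \<xi>))"
    have "\<forall>\<^sub>F \<Lambda> in ?F. finite \<Lambda> \<and> K \<subseteq> \<Lambda>"
      unfolding eventually_finite_subsets_at_top using K by auto
    then have ev: "\<forall>\<^sub>F \<Lambda> in ?F. fv \<Lambda> J \<xi> * ?w \<xi>' = fv \<Lambda> J \<xi>' * ?w \<xi>"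
    proof eventually_elim
      case (elim \<Lambda>)
      then have "balanced \<beta> (fv \<Lambda>) K" using balanced_finite_gibbs by blast
      from this[unfolded balanced_def, rule_format, OF J] off show ?case by simp
    qed
    have "((\<lambda>\<Lambda>. fv \<Lambda> J \<xi>' * ?w \<xi>) \<longlongrightarrow> marg \<mu> J \<xi> * ?w \<xi>') ?F"
      using tendsto_cong[OF ev, THEN iffD1] \<mu>'(3)[OF J(1), of \<xi>] by (simp add: tendsto_mult_right)
    moreover have "((\<lambda>\<Lambda>. fv \<Lambda> J \<xi>' * ?w \<xi>) \<longlongrightarrow> marg \<mu> J \<xi>' * ?w \<xi>) ?F"
      using \<mu>'(3)[OF J(1), of \<xi>'] by (rule tendsto_mult_right)
    ultimately show "marg \<mu> J \<xi> * ?w \<xi>' = marg \<mu> J \<xi>' * ?w \<xi>"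
      by (rule tendsto_unique[rotated]) simp
  qed
  then have G: "\<mu> \<in> gibbs_measures \<beta> adj" using gibbs_measures_iff_balanced[OF \<mu>'(1,2)] by blast
  show ?thesis
    unfolding extremal_gibbs_def
  proof (intro conjI ballI allI impI, rule G)
    fix \<mu>1 \<mu>2 and t :: real
    assume G12: "\<mu>1 \<in> gibbs_measures \<beta> adj" "\<mu>2 \<in> gibbs_measures \<beta> adj"
      and t: "0 < t \<and> t < 1 \<and> (\<forall>A\<in>sets spin_space. measure \<mu> A = t * measure \<mu>1 A + (1 - t) * measure \<mu>2 A)"
    have "\<mu>1 = \<mu>"
      by (rule weak_limit_unique_component[OF \<mu> bal G12(1), of t]) (use t in auto)
    moreover have "\<mu>2 = \<mu>"
      by (rule weak_limit_unique_component[OF \<mu> bal G12(2), of "1 - t"]) (use t in auto)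
    ultimately show "\<mu>1 = \<mu>2" by simp
  qed
qed

end

section \<open>From the graph hypotheses to the low-temperature constants\<close>

lemma transitive_card_neighbours:
  assumes "vertex_transitive adj"
  shows "card {w. adj v w} = card {w. adj v0 w}"
proof -
  obtain \<phi> where \<phi>: "graph_automorphism adj \<phi>" "\<phi> v0 = v"
    using assms unfolding vertex_transitive_def by blast
  then have b: "bij \<phi>" "\<And>a b. adj a b \<longleftrightarrow> adj (\<phi> a) (\<phi> b)" unfolding graph_automorphism_def by blast+
  have "{w. adj v w} = \<phi> ` {w. adj v0 w}"
  proof (intro equalityI subsetI)
    fix w assume w: "w \<in> {w. adj v w}"
    obtain u where u: "w = \<phi> u" using b(1) by (meson bij_pointE)
    then show "w \<in> \<phi> ` {w. adj v0 w}" using w b(2)[of v0 u] \<phi>(2) by simp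
  next
    fix w assume "w \<in> \<phi> ` {w. adj v0 w}"
    then obtain u where u: "w = \<phi> u" "adj v0 u" by blast
    then show "w \<in> {w. adj v w}" using b(2)[of v0 u] \<phi>(2) by simp
  qed
  then show ?thesis using card_image[of \<phi>] b(1) by (metis bij_is_inj inj_on_subset subset_UNIV)
qed

lemma isoperimetric_constant_le:
  assumes "finite F"
  shows "isoperimetric_constant adj * real (card F) \<le> real (card (edge_boundary adj F))"
proof (cases "F = {}")
  case False
  let ?S = "{real (card (edge_boundary adj S)) / real (card S) | S. finite S \<and> S \<noteq> {}}"
  have "isoperimetric_constant adj \<le> real (card (edge_boundary adj F)) / real (card F)"
    unfolding isoperimetric_constant_def
  proof (rule cInf_lower)
    show "real (card (edge_boundary adj F)) / real (card F) \<in> ?S" using assms False by blast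
    show "bdd_below ?S" by (rule bdd_belowI[of _ 0]) auto
  qed
  then show ?thesis using assms False by (simp add: field_simps card_gt_0_iff)
qed simp

theorem theorem2p1:
  fixes adj :: "'v \<Rightarrow> 'v \<Rightarrow> bool" and dmax :: nat
  assumes "simple_graph adj"
    and "connected_graph adj"
    and "vertex_transitive adj"
    and "locally_finite adj"
    and "real dmax < isoperimetric_constant adj / 2"
  shows "\<exists>\<beta>0. \<forall>\<beta>>\<beta>0. \<forall>\<omega> \<in> Omega_GS adj dmax.
           (\<exists>\<mu>. weak_limit_gibbs \<beta> adj \<omega> \<mu>) \<and>
           (\<forall>\<mu>. weak_limit_gibbs \<beta> adj \<omega> \<mu> \<longrightarrow> extremal_gibbs \<beta> adj \<mu>)"
proof -
  \<comment> \<open>By transitivity the degree at one arbitrary vertex is the degree everywhere; the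
    successor secures deg >= 1.\<close>
  define deg where "deg = Suc (card {w. adj undefined w})"
  define c where "c = isoperimetric_constant adj - 2 * real dmax"
  have c: "0 < c" using assms(5) by (simp add: c_def)
  \<comment> \<open>Solves \<open>4 * deg ^ 2 * exp (- \<beta> * c) \<le> 1 / 2\<close> for \<beta>;
    the maximum with 0 gives the sign of \<beta>. The value does not depend on \<omega>.\<close>
  define \<beta>0 where "\<beta>0 = max 0 (ln (8 * real deg ^ 2) / c)"
  have graph: "bounded_degree_graph adj deg"
  proof
    show "card {w. adj v w} \<le> deg" for v
      using transitive_card_neighbours[OF assms(3), of v undefined] by (simp add: deg_def)
  qed (use assms(1,4) in \<open>auto simp: deg_def simple_graph_def locally_finite_def\<close>)
  have "sparse_ground_state adj deg \<omega> \<beta> (isoperimetric_constant adj) dmax"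
    if \<beta>: "\<beta>0 < \<beta>" and \<omega>: "\<omega> \<in> Omega_GS adj dmax" for \<beta> \<omega>
  proof (rule sparse_ground_state.intro[OF graph], unfold_locales)
    show "\<omega> \<in> Omega_GS adj dmax" by fact
    show "0 \<le> \<beta>" using \<beta> by (simp add: \<beta>0_def)
    show "2 * real dmax \<le> isoperimetric_constant adj" using assms(5) by simp
    have "ln (8 * real deg ^ 2) < \<beta> * c" using \<beta> c by (simp add: \<beta>0_def field_simps)
    then have "exp (ln (8 * real deg ^ 2)) < exp (\<beta> * c)" by (rule exp_less_mono)
    moreover have "0 < 8 * real deg ^ 2" by (simp add: deg_def)
    ultimately have "8 * real deg ^ 2 < exp (\<beta> * c)" by (simp only: exp_ln)
    then have "4 * real deg ^ 2 * exp (- \<beta> * c) \<le> 1 / 2"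
      by (simp add: exp_minus field_simps)
    then show "4 * real deg ^ 2 * exp (- \<beta> * (isoperimetric_constant adj - 2 * real dmax)) \<le> 1 / 2"
      by (simp only: c_def)
  qed (rule isoperimetric_constant_le)
  then show ?thesis
    using sparse_ground_state.weak_limit_exists sparse_ground_state.weak_limit_extremal by blast
qed

end
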